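(* Let $\alpha>0$, let $u:E\times\mathbb{R}^{d-1}\to[0,\infty)$ be measurable with $u(x,\mathbf{1})>0$ for all $x\in E$, let $h:\mathbb{R}^{d-1}\to[0,\infty)$ satisfy $h(\mathbf{1})=1$, and suppose that $\bar U(x,\mathbf{y}):=\int_x^{e_1}u(z,\mathbf{y})\,dz$ exists (is finite) for all $x\in E$ and $\mathbf{y}\in\mathbb{R}^{d-1}$. Then the function $(x,\mathbf{y})\mapsto u(x,\mathbf{y})/T'(x)$ belongs to $T\text{-RV}^x_{-\alpha-1}(h)$ if and only if, for every $\mathbf{y}\in\mathbb{R}^{d-1}$, $$\frac{T(t)}{T'(t)}\,\frac{u(t,\mathbf{y})}{\bar U(t,\mathbf{1})}\longrightarrow \alpha\,h(\mathbf{y})\quad\text{as }t\uparrow e_1 .$$ In this case, $\bar U\in T\text{-RV}^x_{-\alpha}(h)$, and its representation has constant coefficient $c(x)\equiv\bar U(e_0,\mathbf{1})$; that is, $$\bar U(x,\mathbf{y})=\bar U(e_0,\mathbf{1})\exp\left\{\int_{e_0}^x a(z)\frac{T'(z)}{T(z)}\,dz\right\}q(x,\mathbf{y})$$ for some measurable functions $a$ on $E$ and $q$ on $E\times\mathbb{R}^{d-1}$ with $a(t)\to-\alpha$ and $q(t,\mathbf{y})\to h(\mathbf{y})$ for every $\mathbf{y}$ as $t\uparrow e_1$.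
   Context: Let $e_0\in\mathbb{R}$, $e_1\in\mathbb{R}\cup\{\infty\}$, $E=[e_0,e_1)$, and let $T:E\to[1,\infty)$ be a diffeomorphism (so $T$ is increasing and $T(e_0)=1$). For $x,y\in E$ put $x\star y:=T^{-1}\{T(x)T(y)\}$. The vector $\mathbf{1}=(1,\dots,1)\in\mathbb{R}^{d-1}$ is called the pivot. A measurable function $w:E\times\mathbb{R}^{d-1}\to[0,\infty)$ with $w(\cdot,\mathbf{1})>0$ is called regularly varying in its first component with decay $T$, index $\beta\in\mathbb{R}$ and limit function $h$ (where $h\ge 0$, $h(\mathbf{1})=1$), written $w\in T\text{-RV}^x_\beta(h)$, if for all $x\in E$ and $\mathbf{y}\in\mathbb{R}^{d-1}$, $$\frac{w(t\star x,\mathbf{y})}{w(t\star e_0,\mathbf{1})}\longrightarrow T(x)^\beta h(\mathbf{y})\quad\text{as } t\uparrow e_1 .$$ *)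

theory Defs
  imports "HOL-Analysis.Analysis"
begin

definition Ico :: "real \<Rightarrow> ereal \<Rightarrow> real set" where
  "Ico e0 e1 = {x. e0 \<le> x \<and> ereal x < e1}"

text \<open>The filter of the left-sided limit at \<open>e1\<close>, for \<open>e1\<close> real or \<open>\<infinity>\<close> (the value at \<open>-\<infinity>\<close> is irrelevant).\<close>

definition up_to :: "ereal \<Rightarrow> real filter" where
  "up_to e1 = (if e1 = \<infinity> then at_top else at_left (real_of_ereal e1))"

text \<open>At an end point belonging to \<open>S\<close> this is the one-sided derivative.\<close>

abbreviation deriv_within :: "(real \<Rightarrow> real) \<Rightarrow> real set \<Rightarrow> real \<Rightarrow> real" where
  "deriv_within f S x \<equiv> vector_derivative f (at x within S)"

definition C1_on :: "(real \<Rightarrow> real) \<Rightarrow> real set \<Rightarrow> bool" where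
  "C1_on f S \<longleftrightarrow>
     (\<exists>f'. (\<forall>x\<in>S. (f has_real_derivative f' x) (at x within S)) \<and> continuous_on S f')"

definition diffeomorphism_betw :: "(real \<Rightarrow> real) \<Rightarrow> real set \<Rightarrow> real set \<Rightarrow> bool" where
  "diffeomorphism_betw f A B \<longleftrightarrow> bij_betw f A B \<and> C1_on f A \<and> C1_on (inv_into A f) B"

definition star :: "real set \<Rightarrow> (real \<Rightarrow> real) \<Rightarrow> real \<Rightarrow> real \<Rightarrow> real" where
  "star E T x y = inv_into E T (T x * T y)"

text \<open>
  \<open>w \<in> T-RV\<^sup>x\<^sub>\<beta>(h)\<close> for functions on \<open>[e0,e1) \<times> \<real>\<^sup>n\<close>; the pivot is the all-ones vector \<open>1\<close>.
  Functions on \<open>[e0,e1)\<close> are total functions whose values off \<open>[e0,e1)\<close> are ignored.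
\<close>

definition T_RV ::
  "real \<Rightarrow> ereal \<Rightarrow> (real \<Rightarrow> real) \<Rightarrow> real \<Rightarrow> (real ^ 'n \<Rightarrow> real) \<Rightarrow> (real \<Rightarrow> real ^ 'n \<Rightarrow> real) set" where
  "T_RV e0 e1 T \<beta> h = {w.
     (\<lambda>(x, y). w x y) \<in> borel_measurable (restrict_space borel (Ico e0 e1 \<times> UNIV)) \<and>
     (\<forall>x\<in>Ico e0 e1. \<forall>y. 0 \<le> w x y) \<and>
     (\<forall>x\<in>Ico e0 e1. 0 < w x 1) \<and>
     (\<forall>y. 0 \<le> h y) \<and> h 1 = 1 \<and>
     (\<forall>x\<in>Ico e0 e1. \<forall>y.
        ((\<lambda>t. w (star (Ico e0 e1) T t x) y / w (star (Ico e0 e1) T t e0) 1)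
          \<longlongrightarrow> T x powr \<beta> * h y) (up_to e1))}"

definition tail_integral ::
  "ereal \<Rightarrow> (real \<Rightarrow> real ^ 'n \<Rightarrow> real) \<Rightarrow> real \<Rightarrow> real ^ 'n \<Rightarrow> real" where
  "tail_integral e1 u x y = (LBINT z=ereal x..e1. u z y)"

end

theory Submission
  imports Defs
begin

text \<open>
  Substituting \<open>s = T z\<close> turns \<open>u(\<sqdot>, y)\<close> into the density \<open>v(s, y) = u(T\<inverse> s, y) / T'(T\<inverse> s)\<close> on
  \<open>[1, \<infinity>)\<close>, with tail integral \<open>V(T x, y) = U(x, y)\<close>, and the claim becomes Karamata's theorem: \<open>v(\<sqdot>, 1)\<close>
  is regularly varying with index \<open>-\<alpha>-1\<close> iff \<open>f(t) = t v(t, 1) / V(t, 1)\<close> tends to \<open>\<alpha>\<close>.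
  If \<open>v(\<sqdot>, 1)\<close> is regularly varying then so is \<open>V(\<sqdot>, 1)\<close>, with index \<open>-\<alpha>\<close>, by comparing the tail integrals of
  \<open>v(s r, 1)\<close> and \<open>v(r, 1)\<close>. Moreover \<open>f\<close> is eventually bounded, so if \<open>f(t\<^sub>n)\<close> tends to \<open>c\<close> along a sequence
  \<open>t\<^sub>n\<close> tending to \<open>\<infinity>\<close>, bounded convergence in
  \<open>1 - V(2 t\<^sub>n, 1) / V(t\<^sub>n, 1) = \<integral> t\<^sub>n v(t\<^sub>n r, 1) / V(t\<^sub>n, 1) dr\<close> over \<open>[1, 2]\<close> gives
  \<open>1 - 2 powr (-\<alpha>) = c (1 - 2 powr (-\<alpha>)) / \<alpha>\<close>, that is \<open>c = \<alpha>\<close>. No uniform convergence theorem is needed.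
  Conversely \<open>V(t s, 1) / V(t, 1)\<close> is the exponential of minus the integral of \<open>f(r) / r\<close> over \<open>[t, t s]\<close>; the same
  formula gives the representation, with \<open>a(z) = - f(T z)\<close> and \<open>q(x, y) = U(x, y) / U(x, 1)\<close>.
\<close>

section \<open>Tail integrals\<close>

text \<open>The range is an unbounded half-line even when \<open>e1\<close> is finite: functions on
  \<open>[e0, e1)\<close> are first extended by 0 (see \<open>ext\<close>), so one notion serves
  before and after the substitution.\<close>

definition tail :: "(real \<Rightarrow> real) \<Rightarrow> real \<Rightarrow> real" where
  "tail f x = (LBINT z:{x..}. f z)"

lemma set_integrable_of_integrable:
  fixes f :: "real \<Rightarrow> real"
  shows "integrable lborel f \<Longrightarrow> A \<in> sets borel \<Longrightarrow> set_integrable lborel A f"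
  unfolding set_integrable_def by (rule integrable_mult_indicator) auto

lemma tail_diff:
  assumes "integrable lborel f" "a \<le> b"
  shows "tail f a - tail f b = (LBINT z:{a..b}. f z)"
proof -
  have "(LBINT z:{a..<b} \<union> {b..}. f z) = (LBINT z:{a..<b}. f z) + (LBINT z:{b..}. f z)"
    by (rule set_integral_Un) (auto intro: set_integrable_of_integrable assms)
  moreover have "{a..<b} \<union> {b..} = {a..}" using assms by auto
  moreover have "(LBINT z:{a..<b}. f z) = (LBINT z:{a..b}. f z)"
    by (rule set_integral_discrete_difference[where X="{b}"]) auto
  ultimately show ?thesis by (simp add: tail_def)
qed

lemma tail_antimono:
  assumes "integrable lborel f" "\<And>x. 0 \<le> f x" "a \<le> b"
  shows "tail f b \<le> tail f a"
proof -
  have "0 \<le> (LBINT z:{a..b}. f z)"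
    unfolding set_lebesgue_integral_def by (intro integral_nonneg_AE) (auto simp: assms)
  then show ?thesis using tail_diff[OF assms(1,3)] by linarith
qed

lemma tail_nonneg: "(\<And>x. 0 \<le> f x) \<Longrightarrow> 0 \<le> tail f a"
  unfolding tail_def set_lebesgue_integral_def by (intro integral_nonneg_AE) auto

text \<open>A vanishing integral would force \<open>f\<close> to be zero almost everywhere on
  \<open>{a..b}\<close>, making an interval of positive length a null set.\<close>

lemma set_integral_Icc_pos:
  fixes a b :: real and f :: "real \<Rightarrow> real"
  assumes f: "set_integrable lborel {a..b} f" and pos: "\<And>x. x \<in> {a..b} \<Longrightarrow> 0 < f x" and "a < b"
  shows "0 < (LBINT z:{a..b}. f z)"
proof -
  let ?f = "\<lambda>z. indicator {a..b} z *\<^sub>R f z"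
  have nn: "AE z in lborel. 0 \<le> ?f z" using pos by (intro AE_I2) (simp add: indicator_def less_imp_le)
  have int: "integrable lborel ?f" using f unfolding set_integrable_def .
  have "integral\<^sup>L lborel ?f \<noteq> 0"
  proof
    assume "integral\<^sup>L lborel ?f = 0"
    then have "AE z in lborel. ?f z = 0" using integral_nonneg_eq_0_iff_AE[OF int nn] by simp
    then have "AE z in lborel. z \<notin> {a..b}"
      by eventually_elim (use pos in \<open>force simp: indicator_def split: if_splits\<close>)
    then have "emeasure lborel {a..b} = 0"
      by (subst (asm) AE_iff_measurable[where N="{a..b}"]) auto
    then show False using \<open>a < b\<close> by simp
  qed
  moreover have "0 \<le> integral\<^sup>L lborel ?f" by (rule integral_nonneg_AE[OF nn])
  ultimately show ?thesis by (simp add: set_lebesgue_integral_def)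
qed

lemma tail_pos:
  assumes f: "integrable lborel f" "\<And>x. 0 \<le> f x" and "a < b" "\<And>x. x \<in> {a..b} \<Longrightarrow> 0 < f x"
  shows "0 < tail f a"
proof -
  have "0 < (LBINT z:{a..b}. f z)"
    by (intro set_integral_Icc_pos set_integrable_of_integrable) (use assms in auto)
  also have "\<dots> = tail f a - tail f b" using tail_diff[OF f(1), of a b] \<open>a < b\<close> by simp
  also have "\<dots> \<le> tail f a" using tail_nonneg[of f b] f by simp
  finally show ?thesis .
qed

lemma continuous_on_tail:
  assumes f: "integrable lborel f"
  shows "continuous_on {a..b} (tail f)"
proof -
  have int: "set_integrable lborel {c..d} f" for c d by (rule set_integrable_of_integrable[OF f]) auto
  have "continuous_on {a..b} (\<lambda>x. tail f a - integral {a..x} f)"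
    by (intro continuous_intros indefinite_integral_continuous_1 set_borel_integral_eq_integral(1) int)
  then show ?thesis
    by (rule continuous_on_eq)
       (use tail_diff[OF f] set_borel_integral_eq_integral(2)[OF int] in \<open>auto simp: algebra_simps\<close>)
qed

lemma tail_scale:
  assumes "s > 0"
  shows "tail f (s * t) = s * tail (\<lambda>r. f (s * r)) t"
proof -
  have "tail f (s * t) = \<bar>s\<bar> *\<^sub>R (LBINT x. indicator {s * t..} (0 + s * x) *\<^sub>R f (0 + s * x))"
    unfolding tail_def set_lebesgue_integral_def by (rule lborel_integral_real_affine) (use assms in auto)
  also have "(\<lambda>x. indicator {s * t..} (0 + s * x) *\<^sub>R f (0 + s * x)) = (\<lambda>x. indicator {t..} x *\<^sub>R f (s * x))"
    using assms by (auto simp: indicator_def fun_eq_iff)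
  finally show ?thesis using assms by (simp add: tail_def set_lebesgue_integral_def)
qed

text \<open>An integral form of l'Hopital's rule: from some point on, \<open>f - L * g\<close> is at
  most a small multiple of \<open>g\<close> in absolute value, and this bound survives integration
  over \<open>{x..}\<close>. It serves twice: for \<open>v (s * r)\<close> against
  \<open>v r\<close>, and for \<open>v r y\<close> against \<open>v r p\<close>.\<close>

lemma tail_ratio_tendsto:
  assumes f: "integrable lborel f" and g: "integrable lborel g" "\<And>x. 0 \<le> g x"
    and pos: "eventually (\<lambda>x. 0 < g x) at_top" "eventually (\<lambda>x. 0 < tail g x) at_top"
    and lim: "((\<lambda>x. f x / g x) \<longlongrightarrow> L) at_top"
  shows "((\<lambda>x. tail f x / tail g x) \<longlongrightarrow> L) at_top"
proof (rule tendstoI)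
  fix e :: real assume "e > 0"
  \<comment> \<open>Half of \<open>e\<close>, because integration yields only weak inequalities
    while the goal is strict.\<close>
  then have "eventually (\<lambda>x. dist (f x / g x) L < e/2) at_top" using lim by (intro tendstoD) auto
  then have "eventually (\<lambda>x. \<bar>f x - L * g x\<bar> \<le> e/2 * g x) at_top" using pos(1)
    by eventually_elim (simp add: dist_real_def divide_simps abs_if split: if_splits; argo)
  then obtain N where N: "\<And>x. x \<ge> N \<Longrightarrow> \<bar>f x - L * g x\<bar> \<le> e/2 * g x"
    by (auto simp: eventually_at_top_linorder)
  show "eventually (\<lambda>x. dist (tail f x / tail g x) L < e) at_top"
    using pos(2) eventually_ge_at_top[of N]
  proof eventually_elim
    case (elim x)
    have int: "set_integrable lborel {x..} f" "set_integrable lborel {x..} g"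
      by (auto intro: set_integrable_of_integrable f g)
    have "tail f x \<le> (LBINT z:{x..}. (L + e/2) * g z)" unfolding tail_def
    proof (intro set_integral_mono int set_integrable_mult_right)
      fix z assume "z \<in> {x..}"
      then show "f z \<le> (L + e/2) * g z"
        using N[of z] elim unfolding abs_le_iff by (auto simp: algebra_simps)
    qed
    moreover have "(LBINT z:{x..}. (L - e/2) * g z) \<le> tail f x" unfolding tail_def
    proof (intro set_integral_mono int set_integrable_mult_right)
      fix z assume "z \<in> {x..}"
      then show "(L - e/2) * g z \<le> f z"
        using N[of z] elim unfolding abs_le_iff by (auto simp: algebra_simps)
    qed
    ultimately have "(L - e/2) * tail g x \<le> tail f x" "tail f x \<le> (L + e/2) * tail g x"
      by (auto simp: tail_def)
    then have "L - e/2 \<le> tail f x / tail g x" "tail f x / tail g x \<le> L + e/2"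
      using elim by (auto simp: divide_simps)
    then show ?case using \<open>e > 0\<close> by (auto simp: dist_real_def abs_if)
  qed
qed

section \<open>The logarithm of a tail integral\<close>

text \<open>Read as a function of the value \<open>W x\<close>, \<open>Q\<close> has increments that
  are quadratically small, so its derivative on the interval \<open>I\<close> is 0 and it is
  constant there.\<close>

lemma constant_if_quadratic_bound:
  fixes Q W :: "real \<Rightarrow> real"
  assumes "a \<le> b" and W: "continuous_on {a..b} W"
    and bound: "\<And>c d. c \<in> {a..b} \<Longrightarrow> d \<in> {a..b} \<Longrightarrow> \<bar>Q c - Q d\<bar> \<le> K * (W c - W d)\<^sup>2"
  shows "Q a = Q b"
proof -
  define I where "I = W ` {a..b}"
  have "convex I" unfolding I_def
    using connected_continuous_image[OF W] is_interval_connected_1 is_interval_convex_1 by blast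
  \<comment> \<open>Any choice of preimages will do, since the bound forces \<open>Q c = Q d\<close>
    whenever \<open>W c = W d\<close>.\<close>
  define p where "p = inv_into {a..b} W"
  have p: "p y \<in> {a..b}" "W (p y) = y" if "y \<in> I" for y
    using that by (auto simp: p_def I_def inv_into_into f_inv_into_f simp del: atLeastAtMost_iff)
  have "((\<lambda>y. Q (p y)) has_field_derivative 0) (at x within I)" if x: "x \<in> I" for x
    unfolding has_field_derivative_iff
  proof (rule Lim_null_comparison)
    have "((\<lambda>y. K * \<bar>y - x\<bar>) \<longlongrightarrow> K * \<bar>x - x\<bar>) (at x within I)" by (intro tendsto_intros)
    then show "((\<lambda>y. K * \<bar>y - x\<bar>) \<longlongrightarrow> 0) (at x within I)" by simp
    show "\<forall>\<^sub>F y in at x within I. norm ((Q (p y) - Q (p x)) / (y - x)) \<le> K * \<bar>y - x\<bar>"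
      unfolding eventually_at_filter
    proof (rule always_eventually, intro allI impI)
      fix y assume "y \<noteq> x" "y \<in> I"
      have "\<bar>Q (p y) - Q (p x)\<bar> \<le> K * (y - x)\<^sup>2" using bound[of "p y" "p x"] p x \<open>y \<in> I\<close> by metis
      then show "norm ((Q (p y) - Q (p x)) / (y - x)) \<le> K * \<bar>y - x\<bar>"
        using \<open>y \<noteq> x\<close> by (simp add: divide_simps abs_divide power2_eq_square mult.assoc abs_mult_self_eq)
    qed
  qed
  then obtain c where c: "\<And>x. x \<in> I \<Longrightarrow> Q (p x) = c"
    using has_field_derivative_zero_constant[OF \<open>convex I\<close>] by blast
  have "Q x = c" if "x \<in> {a..b}" for x
  proof -
    have WI: "W x \<in> I" using that by (auto simp: I_def)
    then have "\<bar>Q x - Q (p (W x))\<bar> \<le> K * (W x - W (p (W x)))\<^sup>2" using that p by (intro bound) blast+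
    then show ?thesis using p(2)[OF WI] c[OF WI] by simp
  qed
  then show ?thesis using \<open>a \<le> b\<close> by simp
qed

text \<open>Both bounds are \<open>ln z \<le> z - 1\<close>, at \<open>z = y / x\<close> and at
  \<open>z = x / y\<close>. With \<open>x\<close> and \<open>y\<close> two values of
  \<open>tail f\<close>, the integral of \<open>f / tail f\<close> between the two points obeys the
  same bounds.\<close>

lemma log_diff_bounds:
  fixes x y :: real
  assumes "0 < y" "y \<le> x"
  shows "(x - y) / x \<le> ln x - ln y" "ln x - ln y \<le> (x - y) / y"
proof -
  have "ln (y / x) \<le> y / x - 1" "ln (x / y) \<le> x / y - 1" using assms by (intro ln_le_minus_one; simp)+
  then show "(x - y) / x \<le> ln x - ln y" "ln x - ln y \<le> (x - y) / y"
    using assms by (auto simp: ln_div diff_divide_distrib)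
qed

text \<open>
  No derivative of \<^term>\<open>tail f\<close> is available for merely integrable \<open>f\<close>; instead both sides
  of the identity have increments within \<open>(tail f c - tail f d)\<^sup>2 / (tail f b)\<^sup>2\<close> of each other.
\<close>

lemma log_tail_diff:
  assumes f: "integrable lborel f" "\<And>x. 0 \<le> f x" and "a \<le> b" and pos: "0 < tail f b"
  shows "set_integrable lborel {a..b} (\<lambda>x. f x / tail f x)"
    and "(LBINT x:{a..b}. f x / tail f x) = ln (tail f a) - ln (tail f b)"
proof -
  let ?G = "tail f"
  \<comment> \<open>Cutting the integrand off outside \<open>{a..b}\<close> makes its integral a
    tail as well, so that \<open>tail_diff\<close> governs its increments.\<close>
  let ?k = "\<lambda>x. indicator {a..b} x *\<^sub>R (f x / ?G x)"
  have anti: "c \<le> d \<Longrightarrow> ?G d \<le> ?G c" for c d using tail_antimono f by blast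
  have Gpos: "?G c > 0" if "c \<le> b" for c using anti[OF that] pos by simp
  have fm[measurable]: "f \<in> borel_measurable borel" using f by auto
  have "(\<lambda>x. indicator {a..b} x *\<^sub>R ?G x) \<in> borel_measurable borel"
    by (rule borel_measurable_continuous_on_indicator) (auto intro: continuous_on_tail f)
  then have "(\<lambda>x. indicator {a..b} x *\<^sub>R f x / (indicator {a..b} x *\<^sub>R ?G x)) \<in> borel_measurable borel" by measurable
  also have "(\<lambda>x. indicator {a..b} x *\<^sub>R f x / (indicator {a..b} x *\<^sub>R ?G x)) = ?k"
    by (auto simp: indicator_def)
  finally have km: "?k \<in> borel_measurable lborel" by simp
  \<comment> \<open>On \<open>{a..b}\<close> the decreasing function \<open>tail f\<close> is at
    least \<open>tail f b\<close>, so \<open>f / tail f b\<close> dominates.\<close>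
  have k: "integrable lborel ?k"
  proof (rule Bochner_Integration.integrable_bound)
    show "integrable lborel (\<lambda>x. f x / ?G b)" using f by simp
    have "?k x \<le> f x / ?G b" for x
      using f(2)[of x] pos anti[of x b] Gpos[of x] by (auto simp: indicator_def intro!: divide_left_mono)
    moreover have "0 \<le> ?k x" for x using f(2)[of x] Gpos[of x] by (auto simp: indicator_def)
    ultimately show "AE x in lborel. norm (?k x) \<le> norm (f x / ?G b)"
      by (intro AE_I2) (metis abs_of_nonneg order_trans real_norm_def)
  qed (fact km)
  then show "set_integrable lborel {a..b} (\<lambda>x. f x / ?G x)" by (simp add: set_integrable_def)
  \<comment> \<open>With \<open>D = ?G c - ?G d\<close>, the increments of the logarithm and of the
    integral both lie between \<open>D / ?G c\<close> and \<open>D / ?G d\<close>, and these two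
    differ by \<open>D\<^sup>2 / (?G c * ?G d)\<close>.\<close>
  have main: "\<bar>(ln (?G c) - tail ?k c) - (ln (?G d) - tail ?k d)\<bar> \<le> 1 / (?G b)\<^sup>2 * (?G c - ?G d)\<^sup>2"
    if "a \<le> c" "c \<le> d" "d \<le> b" for c d
  proof -
    have p: "?G c > 0" "?G d > 0" using Gpos that by auto
    have D: "?G c - ?G d = (LBINT x:{c..d}. f x)" by (rule tail_diff[OF f(1) that(2)])
    have kd: "tail ?k c - tail ?k d = (LBINT x:{c..d}. ?k x)" by (rule tail_diff[OF k that(2)])
    have ik: "set_integrable lborel {c..d} ?k" "set_integrable lborel {c..d} f"
      by (rule set_integrable_of_integrable[OF k] set_integrable_of_integrable[OF f(1)], simp)+
    have "(LBINT x:{c..d}. f x / ?G c) \<le> (LBINT x:{c..d}. ?k x)"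
      using that p by (intro set_integral_mono ik set_integrable_divide)
        (auto simp: indicator_def intro!: divide_left_mono anti f Gpos mult_pos_pos)
    moreover have "(LBINT x:{c..d}. ?k x) \<le> (LBINT x:{c..d}. f x / ?G d)"
      using that p by (intro set_integral_mono ik set_integrable_divide)
        (auto simp: indicator_def intro!: divide_left_mono anti f Gpos mult_pos_pos)
    ultimately have "(?G c - ?G d) / ?G c \<le> tail ?k c - tail ?k d"
        "tail ?k c - tail ?k d \<le> (?G c - ?G d) / ?G d"
      unfolding kd D by simp_all
    moreover note log_diff_bounds[OF p(2) anti[OF that(2)]]
    ultimately have "\<bar>(ln (?G c) - tail ?k c) - (ln (?G d) - tail ?k d)\<bar>
        \<le> (?G c - ?G d) / ?G d - (?G c - ?G d) / ?G c" by linarith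
    also have "\<dots> = (?G c - ?G d)\<^sup>2 / (?G c * ?G d)" using p by (simp add: field_simps power2_eq_square)
    also have "\<dots> \<le> (?G c - ?G d)\<^sup>2 / (?G b)\<^sup>2" unfolding power2_eq_square[of "?G b"]
      using that pos p anti by (intro divide_left_mono mult_mono mult_pos_pos) auto
    finally show ?thesis by simp
  qed
  have "ln (?G a) - tail ?k a = ln (?G b) - tail ?k b"
  proof (rule constant_if_quadratic_bound[OF \<open>a \<le> b\<close> continuous_on_tail[OF f(1)]])
    fix c d assume "c \<in> {a..b}" "d \<in> {a..b}"
    then show "\<bar>(ln (?G c) - tail ?k c) - (ln (?G d) - tail ?k d)\<bar> \<le> 1 / (?G b)\<^sup>2 * (?G c - ?G d)\<^sup>2"
      using main[of c d] main[of d c] by (cases "c \<le> d") (auto simp: power2_commute abs_minus_commute)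
  qed
  then have "ln (?G a) - ln (?G b) = (LBINT x:{a..b}. ?k x)" using tail_diff[OF k \<open>a \<le> b\<close>] by simp
  also have "\<dots> = (LBINT x:{a..b}. f x / ?G x)"
    by (intro set_lebesgue_integral_cong) auto
  finally show "(LBINT x:{a..b}. f x / ?G x) = ln (?G a) - ln (?G b)" by simp
qed

section \<open>Karamata's theorem\<close>

lemma powr_integral:
  fixes \<alpha> :: real
  assumes "\<alpha> > 0"
  shows "(LBINT r:{1..2}. r powr (-\<alpha>-1)) = (1 - 2 powr (-\<alpha>)) / \<alpha>"
proof -
  have "(LBINT r:{1..2}. r powr (-\<alpha>-1)) = (- (2 powr (-\<alpha>)) / \<alpha>) - (- (1 powr (-\<alpha>)) / \<alpha>)"
    unfolding set_lebesgue_integral_def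
  proof (rule integral_FTC_atLeastAtMost)
    fix x :: real assume "1 \<le> x"
    then show "((\<lambda>x. - (x powr (-\<alpha>)) / \<alpha>) has_vector_derivative x powr (-\<alpha>-1)) (at x within {1..2})"
      unfolding has_real_derivative_iff_has_vector_derivative[symmetric]
      using assms by (auto intro!: derivative_eq_intros simp: field_simps)
  qed (auto intro!: continuous_intros)
  then show ?thesis by (simp add: diff_divide_distrib)
qed

lemma inverse_integral:
  fixes a b :: real
  assumes "0 < a" "a \<le> b"
  shows "set_integrable lborel {a..b} (\<lambda>r. 1 / r)" "(LBINT r:{a..b}. 1 / r) = ln b - ln a"
proof -
  have c: "continuous_on {a..b} (\<lambda>r. 1 / r)" using assms by (auto intro!: continuous_intros)
  show "set_integrable lborel {a..b} (\<lambda>r. 1 / r)" by (rule borel_integrable_atLeastAtMost'[OF c])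
  show "(LBINT r:{a..b}. 1 / r) = ln b - ln a" unfolding set_lebesgue_integral_def
    by (rule integral_FTC_atLeastAtMost[OF assms(2) _ c])
      (use assms in \<open>auto intro!: derivative_eq_intros
         simp: has_real_derivative_iff_has_vector_derivative[symmetric]\<close>)
qed

lemma bounded_convergence_Icc:
  fixes \<phi> :: "nat \<Rightarrow> real \<Rightarrow> real"
  assumes [measurable]: "\<And>n. \<phi> n \<in> borel_measurable borel" "\<psi> \<in> borel_measurable borel"
    and "\<And>r. r \<in> {a..b} \<Longrightarrow> (\<lambda>n. \<phi> n r) \<longlonglongrightarrow> \<psi> r"
    and "\<And>n r. r \<in> {a..b} \<Longrightarrow> \<bar>\<phi> n r\<bar> \<le> C"
  shows "(\<lambda>n. LBINT r:{a..b}. \<phi> n r) \<longlonglongrightarrow> (LBINT r:{a..b}. \<psi> r)"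
  unfolding set_lebesgue_integral_def
proof (rule integral_dominated_convergence[where w = "\<lambda>r. indicator {a..b} r * C"])
  show "integrable lborel (\<lambda>r. indicator {a..b} r * C)"
    by (intro integrable_mult_left) (auto simp: integrable_indicator_iff emeasure_lborel_Icc_eq)
qed (use assms(3,4) in \<open>auto simp: indicator_def\<close>)

lemma tail_increment_scaled:
  assumes v: "integrable lborel v" and "t > 0"
  shows "(LBINT r:{1..2}. t * v (t * r)) = tail v t - tail v (t * 2)"
proof -
  have "integrable lborel (\<lambda>r. v (t * r))" using lborel_integrable_real_affine[OF v, of t 0] assms by simp
  from tail_diff[OF this, of 1 2] show ?thesis
    using tail_scale[OF \<open>t > 0\<close>, of v 1] tail_scale[OF \<open>t > 0\<close>, of v 2] by (simp add: algebra_simps)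
qed

section \<open>Karamata's theorem for a single density\<close>

context
  fixes v :: "real \<Rightarrow> real" and \<alpha> :: real
  assumes v_int: "integrable lborel v" and v_nonneg: "\<And>x. 0 \<le> v x"
    and v_pos: "\<And>x. 1 \<le> x \<Longrightarrow> 0 < v x" and \<alpha>_pos: "0 < \<alpha>"
begin

lemma tail_v_pos: "1 \<le> x \<Longrightarrow> 0 < tail v x"
  by (rule tail_pos[of _ _ "x + 1"]) (use v_int v_nonneg v_pos in auto)

lemma v_borel[measurable]: "v \<in> borel_measurable borel"
  using v_int by auto

text \<open>The tails of \<open>v (s * r)\<close> and \<open>v r\<close> have the same limiting
  ratio as the functions themselves; the factor \<open>s\<close> from rescaling raises the exponent
  from \<open>-\<alpha>-1\<close> to \<open>-\<alpha>\<close>.\<close>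

lemma tail_RV_if_RV:
  assumes RV: "((\<lambda>t. v (t * s) / v t) \<longlongrightarrow> s powr (-\<alpha>-1)) at_top" and "1 \<le> s"
  shows "((\<lambda>t. tail v (t * s) / tail v t) \<longlongrightarrow> s powr (-\<alpha>)) at_top"
proof -
  have "((\<lambda>t. tail (\<lambda>r. v (s * r)) t / tail v t) \<longlongrightarrow> s powr (-\<alpha>-1)) at_top"
  proof (rule tail_ratio_tendsto)
    show "integrable lborel (\<lambda>r. v (s * r))"
      using lborel_integrable_real_affine[OF v_int, of s 0] \<open>1 \<le> s\<close> by simp
    show "\<forall>\<^sub>F x in at_top. 0 < v x" "\<forall>\<^sub>F x in at_top. 0 < tail v x"
      using eventually_ge_at_top[of 1] by (eventually_elim, simp add: v_pos tail_v_pos)+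
    show "((\<lambda>x. v (s * x) / v x) \<longlongrightarrow> s powr (-\<alpha>-1)) at_top"
      using RV by (simp add: mult.commute)
  qed (use v_int v_nonneg in auto)
  from tendsto_mult[OF tendsto_const[of s] this]
  have "((\<lambda>t. s * (tail (\<lambda>r. v (s * r)) t / tail v t)) \<longlongrightarrow> s * s powr (-\<alpha>-1)) at_top" .
  moreover have "s * s powr (-\<alpha>-1) = s powr (-\<alpha>)"
    using \<open>1 \<le> s\<close> by (simp add: powr_diff)
  ultimately show ?thesis
    using tail_scale[of s v] \<open>1 \<le> s\<close> by (simp add: mult.commute)
qed

text \<open>For large \<open>t\<close>, \<open>v r / tail v r\<close> lies between
  \<open>(\<alpha> - d) / r\<close> and \<open>(\<alpha> + d) / r\<close> on
  \<open>[t, t * s]\<close>. Integrating, with \<open>log_tail_diff\<close> for the middle term,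
  pins the logarithm of the tail ratio near \<open>\<alpha> * ln s\<close> up to sign.\<close>

lemma tail_RV_if_Karamata_ratio:
  assumes lim: "((\<lambda>t. t * v t / tail v t) \<longlongrightarrow> \<alpha>) at_top" and s: "1 \<le> s"
  shows "((\<lambda>t. tail v (t * s) / tail v t) \<longlongrightarrow> s powr (-\<alpha>)) at_top"
proof -
  have "((\<lambda>t. ln (tail v t) - ln (tail v (t * s))) \<longlongrightarrow> \<alpha> * ln s) at_top"
  proof (rule tendstoI)
    fix e :: real assume "e > 0"
    \<comment> \<open>Chosen so that \<open>d * ln s < e\<close>; the summand 1 keeps the
      denominator positive for \<open>s = 1\<close>.\<close>
    define d where "d = e / (2 * (ln s + 1))"
    have "ln s \<ge> 0" using s by simp
    then have d: "d > 0" "d * ln s < e"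
      using \<open>e > 0\<close> mult_nonneg_nonneg[of e "ln s"] by (auto simp: d_def field_simps intro!: add_nonneg_pos)
    then have "eventually (\<lambda>t. dist (t * v t / tail v t) \<alpha> < d) at_top" using lim by (intro tendstoD)
    then obtain N where N: "\<And>t. t \<ge> N \<Longrightarrow> dist (t * v t / tail v t) \<alpha> < d"
      by (auto simp: eventually_at_top_linorder)
    show "eventually (\<lambda>t. dist (ln (tail v t) - ln (tail v (t * s))) (\<alpha> * ln s) < e) at_top"
      using eventually_ge_at_top[of N] eventually_ge_at_top[of 1]
    proof eventually_elim
      case (elim t)
      have le: "t \<le> t * s" using elim s by (simp add: mult_le_cancel_left1)
      note L = log_tail_diff[OF v_int v_nonneg le tail_v_pos]
      note I = inverse_integral[of t "t * s"]
      have I2: "(LBINT r:{t..t * s}. c * (1 / r)) = c * ln s" for c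
        unfolding set_integral_mult_right using I(2) elim le s by (simp add: ln_mult)
      have int: "set_integrable lborel {t..t * s} (\<lambda>r. c * (1 / r))" for c
        using I elim le by (intro set_integrable_mult_right) auto
      have b: "(\<alpha> - d) * (1 / r) \<le> v r / tail v r" "v r / tail v r \<le> (\<alpha> + d) * (1 / r)" if "r \<in> {t..t * s}" for r
      proof -
        have "\<bar>r * v r / tail v r - \<alpha>\<bar> < d" using N[of r] that elim by (simp add: dist_real_def)
        then have "\<alpha> - d \<le> r * (v r / tail v r)" "r * (v r / tail v r) \<le> \<alpha> + d"
          by (auto simp: abs_less_iff)
        moreover have "r > 0" using that elim by auto
        ultimately show "(\<alpha> - d) * (1 / r) \<le> v r / tail v r" "v r / tail v r \<le> (\<alpha> + d) * (1 / r)"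
          by (simp_all add: pos_divide_le_eq pos_le_divide_eq mult.commute)
      qed
      have ts: "1 \<le> t * s" using le elim by linarith
      have "(LBINT r:{t..t * s}. (\<alpha> - d) * (1 / r)) \<le> (LBINT r:{t..t * s}. v r / tail v r)"
           "(LBINT r:{t..t * s}. v r / tail v r) \<le> (LBINT r:{t..t * s}. (\<alpha> + d) * (1 / r))"
        by (intro set_integral_mono int L(1) b ts; assumption)+
      then have "(\<alpha> - d) * ln s \<le> ln (tail v t) - ln (tail v (t * s))"
          "ln (tail v t) - ln (tail v (t * s)) \<le> (\<alpha> + d) * ln s"
        unfolding I2 L(2)[OF ts] by auto
      then show ?case using d by (auto simp: dist_real_def abs_if algebra_simps)
    qed
  qed
  then have "((\<lambda>t. exp (- (ln (tail v t) - ln (tail v (t * s))))) \<longlongrightarrow> exp (- (\<alpha> * ln s))) at_top"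
    by (intro tendsto_intros)
  also have "exp (- (\<alpha> * ln s)) = s powr (-\<alpha>)" using s by (simp add: powr_def)
  finally show ?thesis
  proof (rule Lim_transform_eventually)
    show "eventually (\<lambda>t. exp (- (ln (tail v t) - ln (tail v (t * s)))) = tail v (t * s) / tail v t) at_top"
      using eventually_ge_at_top[of 1]
    proof eventually_elim
      case (elim t)
      then have "1 \<le> t * s" using s mult_mono[of 1 t 1 s] by simp
      then show ?case using elim by (simp add: exp_diff tail_v_pos)
    qed
  qed
qed

context
  assumes RV: "\<And>s. 1 \<le> s \<Longrightarrow> ((\<lambda>t. v (t * s) / v t) \<longlongrightarrow> s powr (-\<alpha>-1)) at_top"
begin

text \<open>If the ratio exceeded \<open>n\<close> at points \<open>t n\<close>, the integral of
  \<open>v (t n * r) / v (t n)\<close> over \<open>[1, 2]\<close> would be at most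
  \<open>tail v (t n) / (t n * v (t n))\<close>, hence tend to 0. Truncating the integrand at 1
  permits bounded convergence, which gives the positive limit \<open>?J\<close> instead.\<close>

lemma Karamata_ratio_bounded: "\<exists>C. eventually (\<lambda>t. t * v t / tail v t \<le> C) at_top"
proof (rule ccontr)
  assume "\<not> ?thesis"
  \<comment> \<open>The bound \<open>n + 1\<close> makes \<open>t\<close> tend to infinity and keeps
    every \<open>t n\<close> at least 1, where \<open>v\<close> and its tail are positive.\<close>
  then have "\<exists>t\<ge>real n + 1. t * v t / tail v t > real n" for n
    unfolding eventually_at_top_linorder by (metis linorder_not_le)
  then obtain t where t: "\<And>n. t n \<ge> real n + 1" "\<And>n. t n * v (t n) / tail v (t n) > real n" by metis
  have t1: "t n \<ge> 1" for n using t(1)[of n] by simp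
  have lim: "filterlim t at_top sequentially"
    by (rule filterlim_at_top_mono[OF filterlim_real_sequentially])
      (intro always_eventually allI order_trans[OF _ t(1)], simp)
  \<comment> \<open>The cut at 1 provides the uniform bound and leaves the limit unchanged, because
    \<open>r powr (-\<alpha>-1) \<le> 1\<close> on \<open>[1, 2]\<close>.\<close>
  let ?\<phi> = "\<lambda>n r. min (v (t n * r) / v (t n)) 1"
  let ?J = "LBINT r:{1..2}. r powr (-\<alpha>-1)"
  have "(\<lambda>n. LBINT r:{1..2}. ?\<phi> n r) \<longlonglongrightarrow> ?J"
  proof (rule bounded_convergence_Icc[where C = 1])
    fix r :: real assume r: "r \<in> {1..2}"
    then have "(\<lambda>n. v (t n * r) / v (t n)) \<longlonglongrightarrow> r powr (-\<alpha>-1)"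
      by (intro filterlim_compose[OF RV lim]) auto
    then have "(\<lambda>n. ?\<phi> n r) \<longlonglongrightarrow> min (r powr (-\<alpha>-1)) 1" by (intro tendsto_intros)
    moreover have "r powr (-\<alpha>-1) \<le> 1" using r \<alpha>_pos powr_mono[of "-\<alpha>-1" 0 r] by simp
    ultimately show "(\<lambda>n. ?\<phi> n r) \<longlonglongrightarrow> r powr (-\<alpha>-1)" by (simp add: min_def)
    show "\<bar>?\<phi> n r\<bar> \<le> 1" for n
      using divide_nonneg_nonneg[OF v_nonneg v_nonneg, of "t n * r" "t n"] by linarith
  qed measurable
  moreover have "(\<lambda>n. LBINT r:{1..2}. ?\<phi> n r) \<longlonglongrightarrow> 0"
  \<comment> \<open>The shift by one avoids the index 0, for which the upper bound
    \<open>1 / n\<close> has no meaning.\<close>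
  proof (rule LIMSEQ_imp_Suc, rule tendsto_sandwich[OF _ _ tendsto_const LIMSEQ_inverse_real_of_nat])
    show "\<forall>\<^sub>F n in sequentially. 0 \<le> (LBINT r:{1..2}. ?\<phi> (Suc n) r)"
      unfolding set_lebesgue_integral_def
      by (intro always_eventually allI integral_nonneg_AE AE_I2) (auto simp: v_nonneg)
    show "\<forall>\<^sub>F n in sequentially. (LBINT r:{1..2}. ?\<phi> (Suc n) r) \<le> inverse (real (Suc n))"
    proof (intro always_eventually allI)
      fix n
      let ?t = "t (Suc n)"
      have p: "0 < ?t * v ?t" "0 < tail v ?t" using v_pos[OF t1] t1[of "Suc n"] tail_v_pos[OF t1] by auto
      have int: "integrable lborel (\<lambda>r. v (?t * r) / v ?t)"
        using lborel_integrable_real_affine[OF v_int, of ?t 0] t1[of "Suc n"] by simp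
      have int': "integrable lborel (\<lambda>r. ?\<phi> (Suc n) r)"
        by (rule Bochner_Integration.integrable_bound[OF int]) (auto simp: v_nonneg min_def)
      have "(LBINT r:{1..2}. ?\<phi> (Suc n) r) \<le> (LBINT r:{1..2}. v (?t * r) / v ?t)"
        by (intro set_integral_mono set_integrable_of_integrable int int') auto
      also have "\<dots> = (LBINT r:{1..2}. ?t * v (?t * r)) / (?t * v ?t)"
        using p t1[of "Suc n"] by auto
      also have "\<dots> \<le> tail v ?t / (?t * v ?t)"
        using p tail_nonneg[of v "?t * 2"] v_nonneg tail_increment_scaled[OF v_int, of ?t] t1[of "Suc n"]
        by (intro divide_right_mono) auto
      also have "\<dots> \<le> inverse (real (Suc n))"
        using t(2)[of "Suc n"] p by (simp add: field_simps)
      finally show "(LBINT r:{1..2}. ?\<phi> (Suc n) r) \<le> inverse (real (Suc n))" .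
    qed
  qed
  ultimately have "?J = 0" by (rule LIMSEQ_unique)
  moreover have "2 powr (-\<alpha>) < 1" using \<alpha>_pos by (simp add: powr_less_one)
  ultimately show False using powr_integral[OF \<alpha>_pos] \<alpha>_pos by simp
qed

text \<open>The ratio eventually stays in the compact set \<open>[0, C]\<close>, so failure of
  convergence would produce a subsequential limit \<open>c\<close> away from
  \<open>\<alpha>\<close>; evaluating the mass of \<open>[1, 2]\<close> in two ways shows
  \<open>c = \<alpha>\<close>.\<close>

lemma Karamata_ratio:
  "((\<lambda>t. t * v t / tail v t) \<longlongrightarrow> \<alpha>) at_top"
proof (rule ccontr)
  let ?f = "\<lambda>t. t * v t / tail v t"
  assume "\<not> ?thesis"
  then obtain e where e: "e > 0" "\<not> eventually (\<lambda>t. dist (?f t) \<alpha> < e) at_top"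
    by (simp only: tendsto_iff not_all not_imp) blast
  obtain C T where C: "\<And>t. t \<ge> T \<Longrightarrow> ?f t \<le> C"
    using Karamata_ratio_bounded by (auto simp: eventually_at_top_linorder)
  \<comment> \<open>\<open>n\<close> gives divergence, 1 positivity, and the threshold
    \<open>T\<close> (here a real number) the bound \<open>C\<close>.\<close>
  have "\<exists>t\<ge>max (real n) (max 1 T). dist (?f t) \<alpha> \<ge> e" for n
    using e(2) unfolding eventually_at_top_linorder by (metis linorder_not_le)
  then obtain t0 where t0: "\<And>n. t0 n \<ge> max (real n) (max 1 T)" "\<And>n. dist (?f (t0 n)) \<alpha> \<ge> e" by metis
  have fnn: "?f t \<ge> 0" if "t \<ge> 1" for t using that by (simp add: v_nonneg tail_v_pos less_imp_le)
  have "?f (t0 n) \<in> {0..C}" for n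
    using t0(1)[of n] C[of "t0 n"] fnn[of "t0 n"] by simp
  then obtain c \<sigma> where \<sigma>: "strict_mono \<sigma>" and c: "((\<lambda>n. ?f (t0 n)) \<circ> \<sigma>) \<longlonglongrightarrow> c"
    using compact_Icc[of 0 C, unfolded compact_def, rule_format, of "\<lambda>n. ?f (t0 n)"] by blast
  define t where "t = t0 \<circ> \<sigma>"
  have c: "(\<lambda>n. ?f (t n)) \<longlonglongrightarrow> c" using c by (simp add: t_def o_def)
  have t: "t n \<ge> 1" "t n \<ge> T" "dist (?f (t n)) \<alpha> \<ge> e" for n using t0[of "\<sigma> n"] by (auto simp: t_def)
  have "t n \<ge> real n" for n
    using t0(1)[of "\<sigma> n"] strict_mono_imp_increasing[OF \<sigma>, of n] by (simp add: t_def)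
  then have lim: "filterlim t at_top sequentially"
    by (intro filterlim_at_top_mono[OF filterlim_real_sequentially] always_eventually) auto
  let ?\<phi> = "\<lambda>n r. t n * v (t n * r) / tail v (t n)"
  have "(\<lambda>n. LBINT r:{1..2}. ?\<phi> n r) \<longlonglongrightarrow> (LBINT r:{1..2}. c * r powr (-\<alpha>-1))"
  proof (rule bounded_convergence_Icc[where C = C])
    fix r :: real assume r: "r \<in> {1..2}"
    then have "(\<lambda>n. v (t n * r) / v (t n)) \<longlonglongrightarrow> r powr (-\<alpha>-1)"
      by (intro filterlim_compose[OF RV lim]) auto
    from tendsto_mult[OF c this]
    have "(\<lambda>n. ?f (t n) * (v (t n * r) / v (t n))) \<longlonglongrightarrow> c * r powr (-\<alpha>-1)" .
    moreover have "?f (t n) * (v (t n * r) / v (t n)) = ?\<phi> n r" for n using v_pos[of "t n"] t(1)[of n] by simp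
    ultimately show "(\<lambda>n. ?\<phi> n r) \<longlonglongrightarrow> c * r powr (-\<alpha>-1)" by simp
    fix n
    have le: "t n \<le> t n * r" using t(1)[of n] r by (simp add: mult_le_cancel_left1)
    have p: "0 < tail v (t n * r)" "0 < tail v (t n)" using le t(1)[of n] order_trans[OF t(1) le] by (auto intro!: tail_v_pos)
    \<comment> \<open>Replacing \<open>tail v (t n)\<close> by the smaller
      \<open>tail v (t n * r)\<close> and inserting the factor \<open>r \<ge> 1\<close> bounds the
      integrand by the Karamata ratio at \<open>t n * r\<close>, hence by \<open>C\<close>.\<close>
    have "?\<phi> n r \<le> t n * v (t n * r) / tail v (t n * r)"
      using p t(1)[of n] tail_antimono[OF v_int v_nonneg le] v_nonneg by (intro divide_left_mono) auto
    also have "\<dots> \<le> (t n * r) * v (t n * r) / tail v (t n * r)"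
      using p le v_nonneg by (intro divide_right_mono mult_right_mono) auto
    also have "\<dots> \<le> C" using C[of "t n * r"] le t(2)[of n] by simp
    finally show "\<bar>?\<phi> n r\<bar> \<le> C" using p t(1)[of n] v_nonneg by simp
  qed auto
  \<comment> \<open>The same integrals are exact tail increments, whose limit is known from
    \<open>tail_RV_if_RV\<close> at \<open>s = 2\<close>.\<close>
  also have "(\<lambda>n. LBINT r:{1..2}. ?\<phi> n r) = (\<lambda>n. 1 - tail v (t n * 2) / tail v (t n))"
  proof
    fix n
    have "(LBINT r:{1..2}. ?\<phi> n r) = (tail v (t n) - tail v (t n * 2)) / tail v (t n)"
      using tail_increment_scaled[OF v_int, of "t n"] t(1)[of n] by simp
    then show "(LBINT r:{1..2}. ?\<phi> n r) = 1 - tail v (t n * 2) / tail v (t n)"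
      using tail_v_pos[OF t(1)[of n]] by (simp add: diff_divide_distrib)
  qed
  finally have "(\<lambda>n. 1 - tail v (t n * 2) / tail v (t n)) \<longlonglongrightarrow> c * ((1 - 2 powr (-\<alpha>)) / \<alpha>)"
    by (simp add: powr_integral[OF \<alpha>_pos])
  moreover have "(\<lambda>n. 1 - tail v (t n * 2) / tail v (t n)) \<longlonglongrightarrow> 1 - 2 powr (-\<alpha>)"
    by (intro tendsto_intros filterlim_compose[OF tail_RV_if_RV lim] RV) auto
  ultimately have "c * ((1 - 2 powr (-\<alpha>)) / \<alpha>) = 1 - 2 powr (-\<alpha>)" by (rule LIMSEQ_unique)
  then have "(1 - 2 powr (-\<alpha>)) * (c - \<alpha>) = 0" using \<alpha>_pos by (simp add: field_simps)
  moreover have "2 powr (-\<alpha>) < 1" using \<alpha>_pos by (simp add: powr_less_one)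
  ultimately have "c = \<alpha>" using \<alpha>_pos by simp
  then have "eventually (\<lambda>n. dist (?f (t n)) \<alpha> < e) sequentially" using c e(1) by (auto intro: tendstoD)
  then show False using t(3) by (auto simp: eventually_sequentially linorder_not_less[symmetric])
qed

end

end

section \<open>Karamata's theorem for a family with a pivot\<close>

text \<open>Only the pivot \<open>p\<close> needs Karamata's theorem. The other parameters are
  compared with it: \<open>v t y / v t p\<close> tends to \<open>h y\<close>, and by
  \<open>tail_ratio_tendsto\<close> so does \<open>V t y / V t p\<close>.\<close>

lemma Karamata_family:
  fixes v :: "real \<Rightarrow> 'a \<Rightarrow> real" and p :: 'a and h :: "'a \<Rightarrow> real"
  assumes int: "\<And>y. integrable lborel (\<lambda>t. v t y)" and nonneg: "\<And>t y. 0 \<le> v t y"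
    and pos: "\<And>t. 1 \<le> t \<Longrightarrow> 0 < v t p" and \<alpha>: "0 < \<alpha>" and h: "h p = 1"
  defines "V \<equiv> \<lambda>t y. tail (\<lambda>r. v r y) t"
  shows "(\<forall>s\<ge>1. \<forall>y. ((\<lambda>t. v (t * s) y / v t p) \<longlongrightarrow> s powr (-\<alpha>-1) * h y) at_top) \<longleftrightarrow>
      (\<forall>y. ((\<lambda>t. t * v t y / V t p) \<longlongrightarrow> \<alpha> * h y) at_top)" (is "?A \<longleftrightarrow> ?B")
    and "(\<forall>s\<ge>1. \<forall>y. ((\<lambda>t. v (t * s) y / v t p) \<longlongrightarrow> s powr (-\<alpha>-1) * h y) at_top) \<Longrightarrow> 1 \<le> s \<Longrightarrow>
      ((\<lambda>t. V (t * s) y / V t p) \<longlongrightarrow> s powr (-\<alpha>) * h y) at_top"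
proof -
  note K = int[of p] nonneg pos \<alpha>
  have Vpos: "0 < V t p" if "1 \<le> t" for t using tail_v_pos[OF K that] by (simp add: V_def)
  have scale: "filterlim (\<lambda>t. t * s) at_top at_top" if "1 \<le> s" for s :: real
    using filterlim_tendsto_pos_mult_at_top[OF tendsto_const _ filterlim_ident, of s] that
    by (simp add: mult.commute)
  have RV: "((\<lambda>t. v (t * s) p / v t p) \<longlongrightarrow> s powr (-\<alpha>-1)) at_top" if ?A "1 \<le> s" for s
    using that(1)[rule_format, OF that(2), of p] h by simp
  show "?A \<longleftrightarrow> ?B"
  proof
    assume A: ?A
    show ?B
    proof
      fix y
      \<comment> \<open>The instance \<open>s = 1\<close> isolates the dependence on
        \<open>y\<close>.\<close>
      have "((\<lambda>t. v (t * 1) y / v t p) \<longlongrightarrow> 1 powr (-\<alpha>-1) * h y) at_top" using A by blast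
      from tendsto_mult[OF Karamata_ratio[OF K RV[OF A]] this]
      have "((\<lambda>t. t * v t p / V t p * (v t y / v t p)) \<longlongrightarrow> \<alpha> * h y) at_top" by (simp add: V_def)
      moreover have "eventually (\<lambda>t. t * v t p / V t p * (v t y / v t p) = t * v t y / V t p) at_top"
        using eventually_ge_at_top[of 1]
        by eventually_elim (use pos in force)
      ultimately show "((\<lambda>t. t * v t y / V t p) \<longlongrightarrow> \<alpha> * h y) at_top"
        by (rule Lim_transform_eventually)
    qed
  next
    assume B: ?B
    show ?A
    proof (intro allI impI)
      fix s :: real and y assume s: "1 \<le> s"
      have B1: "((\<lambda>t. t * v t p / V t p) \<longlongrightarrow> \<alpha>) at_top" using B h by (metis mult.right_neutral)
      have "((\<lambda>t. V (t * s) p / V t p) \<longlongrightarrow> s powr (-\<alpha>)) at_top"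
        using tail_RV_if_Karamata_ratio[OF K B1[unfolded V_def] s] by (simp add: V_def)
      moreover have "((\<lambda>t. (t * s) * v (t * s) y / V (t * s) p) \<longlongrightarrow> \<alpha> * h y) at_top"
        using filterlim_compose[OF spec[OF B] scale[OF s]] .
      \<comment> \<open>The quotient \<open>v (t * s) y / v t p\<close> is the Karamata ratio for
        \<open>y\<close> at \<open>t * s\<close>, divided by that for \<open>p\<close> at
        \<open>t\<close>, times the tail ratio at \<open>p\<close>, divided by
        \<open>s\<close>.\<close>
      ultimately have "((\<lambda>t. ((t * s) * v (t * s) y / V (t * s) p) / (t * v t p / V t p)
          * (V (t * s) p / V t p) / s) \<longlongrightarrow> (\<alpha> * h y) / \<alpha> * s powr (-\<alpha>) / s) at_top"
        using B1 \<alpha> s by (intro tendsto_intros) auto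
      also have "(\<alpha> * h y) / \<alpha> * s powr (-\<alpha>) / s = s powr (-\<alpha>-1) * h y"
        using \<alpha> s by (simp add: powr_diff)
      finally show "((\<lambda>t. v (t * s) y / v t p) \<longlongrightarrow> s powr (-\<alpha>-1) * h y) at_top"
      proof (rule Lim_transform_eventually)
        show "eventually (\<lambda>t. ((t * s) * v (t * s) y / V (t * s) p) / (t * v t p / V t p)
          * (V (t * s) p / V t p) / s = v (t * s) y / v t p) at_top"
          using eventually_ge_at_top[of 1]
        proof eventually_elim
          case (elim t)
          have "1 \<le> t * s" using elim s mult_mono[of 1 t 1 s] by simp
          then show ?case using elim s pos[of t] Vpos[of t] Vpos[of "t * s"] by (simp add: field_simps)
        qed
      qed
    qed
  qed
  assume A: ?A and s: "1 \<le> s"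
  have "((\<lambda>t. v (t * 1) y / v t p) \<longlongrightarrow> 1 powr (-\<alpha>-1) * h y) at_top" using A by blast
  \<comment> \<open>Integrated comparison with the pivot; it is used below at \<open>t * s\<close>
    together with the regular variation of \<open>V\<close> at \<open>p\<close>.\<close>
  then have "((\<lambda>t. V t y / V t p) \<longlongrightarrow> h y) at_top" unfolding V_def
    by (intro tail_ratio_tendsto eventually_mono[OF eventually_ge_at_top[of 1]] int nonneg)
       (use pos Vpos in \<open>auto simp: V_def\<close>)
  from tendsto_mult[OF tail_RV_if_RV[OF K RV[OF A s] s] filterlim_compose[OF this scale[OF s]]]
  have "((\<lambda>t. V (t * s) p / V t p * (V (t * s) y / V (t * s) p)) \<longlongrightarrow> s powr (-\<alpha>) * h y) at_top"
    by (simp add: V_def)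
  then show "((\<lambda>t. V (t * s) y / V t p) \<longlongrightarrow> s powr (-\<alpha>) * h y) at_top"
  proof (rule Lim_transform_eventually)
    show "eventually (\<lambda>t. V (t * s) p / V t p * (V (t * s) y / V (t * s) p) = V (t * s) y / V t p) at_top"
      using eventually_ge_at_top[of 1]
    proof eventually_elim
      case (elim t)
      have "1 \<le> t * s" using elim s mult_mono[of 1 t 1 s] by simp
      then show ?case using Vpos[of "t * s"] by simp
    qed
  qed
qed

section \<open>Change of time\<close>

lemma is_interval_Ico: "is_interval (Ico e0 e1)"
  unfolding is_interval_1
proof (intro ballI allI impI)
  fix a b x assume "a \<in> Ico e0 e1" "b \<in> Ico e0 e1" "a \<le> x \<and> x \<le> b"
  then show "x \<in> Ico e0 e1" using le_less_trans[of "ereal x" "ereal b" e1] by (simp add: Ico_def)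
qed

lemma Ico_borel[measurable]: "Ico e0 e1 \<in> sets borel"
proof -
  have "Ico e0 e1 = {x \<in> space borel. e0 \<le> x \<and> ereal x < e1}" by (simp add: Ico_def)
  also have "\<dots> \<in> sets borel" by measurable
  finally show ?thesis .
qed

text \<open>One description of the limit point for finite and infinite \<open>e1\<close>, which
  makes the case distinction in \<open>up_to\<close> invisible afterwards.\<close>

lemma eventually_up_to:
  assumes "ereal e0 < e1"
  shows "eventually P (up_to e1) \<longleftrightarrow> (\<exists>b\<in>Ico e0 e1. \<forall>x\<in>Ico e0 e1. b \<le> x \<longrightarrow> P x)"
proof (cases e1)
  case PInf
  have "(\<exists>N. \<forall>x\<ge>N. P x) \<longleftrightarrow> (\<exists>b\<ge>e0. \<forall>x\<ge>e0. b \<le> x \<longrightarrow> P x)" (is "?L \<longleftrightarrow> ?R")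
  proof
    assume ?L
    then obtain N where "\<forall>x\<ge>N. P x" ..
    then show ?R by (intro exI[of _ "max e0 N"]) auto
  next
    assume ?R
    then obtain b where "b \<ge> e0" "\<forall>x\<ge>e0. b \<le> x \<longrightarrow> P x" by blast
    then show ?L by (intro exI[of _ b]) auto
  qed
  then show ?thesis using PInf by (auto simp: up_to_def eventually_at_top_linorder Ico_def)
next
  case (real r)
  have "e0 < r" using assms real by simp
  have "(\<exists>b<r. \<forall>y>b. y < r \<longrightarrow> P y) \<longleftrightarrow> (\<exists>b\<ge>e0. b < r \<and> (\<forall>x\<ge>e0. x < r \<longrightarrow> b \<le> x \<longrightarrow> P x))" (is "?L \<longleftrightarrow> ?R")
  proof
    assume ?L
    then obtain b where b: "b < r" "\<forall>y>b. y < r \<longrightarrow> P y" by blast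
    \<comment> \<open>The midpoint lies strictly beyond \<open>b\<close>, as the left-sided
      neighbourhood is open at \<open>b\<close>; the maximum keeps the witness in
      \<open>Ico e0 e1\<close>.\<close>
    show ?R using b \<open>e0 < r\<close> by (intro exI[of _ "max e0 ((b + r) / 2)"]) auto
  next
    assume ?R
    then obtain b where "b \<ge> e0" "b < r" "\<forall>x\<ge>e0. x < r \<longrightarrow> b \<le> x \<longrightarrow> P x" by blast
    then show ?L by (intro exI[of _ b]) auto
  qed
  moreover have "eventually P (at_left r) \<longleftrightarrow> (\<exists>b<r. \<forall>y>b. y < r \<longrightarrow> P y)"
    by (rule eventually_at_left[OF \<open>e0 < r\<close>])
  ultimately show ?thesis using real by (simp add: up_to_def Ico_def Bex_def Ball_def conj_assoc imp_conjL)
qed (use assms in auto)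

section \<open>The diffeomorphism T and its inverse S\<close>

locale decay =
  fixes e0 :: real and e1 :: ereal and T :: "real \<Rightarrow> real"
  assumes less: "ereal e0 < e1" and diffeo: "diffeomorphism_betw T (Ico e0 e1) {1..}"
begin

abbreviation E :: "real set" where "E \<equiv> Ico e0 e1"
abbreviation T' :: "real \<Rightarrow> real" where "T' \<equiv> deriv_within T E"
abbreviation S :: "real \<Rightarrow> real" where "S \<equiv> inv_into E T"

lemma e0_in_E: "e0 \<in> E"
  using less by (simp add: Ico_def)

lemma bij: "bij_betw T E {1..}"
  using diffeo by (simp add: diffeomorphism_betw_def)

lemma T_ge_1: "x \<in> E \<Longrightarrow> 1 \<le> T x"
  using bij by (auto simp: bij_betw_def)

lemma S_in_E: "1 \<le> s \<Longrightarrow> S s \<in> E"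
  using bij by (simp add: bij_betw_def inv_into_into)

lemma T_S: "1 \<le> s \<Longrightarrow> T (S s) = s"
  using bij by (simp add: bij_betw_def f_inv_into_f)

lemma S_T: "x \<in> E \<Longrightarrow> S (T x) = x"
  using bij by (simp add: bij_betw_def inv_into_f_f)

lemma Icc_subset_E: "a \<in> E \<Longrightarrow> b \<in> E \<Longrightarrow> {a..b} \<subseteq> E"
  using is_interval_Ico[of e0 e1] unfolding is_interval_1 by (meson atLeastAtMost_iff subsetI)

lemma E_no_max:
  assumes "x \<in> E" obtains b where "b \<in> E" "x < b"
proof -
  have "ereal x < e1" using assms by (simp add: Ico_def)
  then obtain b where "ereal x < ereal b" "ereal b < e1" using ereal_dense2 by blast
  then show ?thesis using assms that[of b] by (auto simp: Ico_def)
qed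

lemma continuous_T: "continuous_on E T"
proof -
  have "\<exists>D. (T has_real_derivative D) (at x within E)" if "x \<in> E" for x
    using diffeo that by (auto simp: diffeomorphism_betw_def C1_on_def)
  then show ?thesis
    by (metis DERIV_continuous continuous_on_eq_continuous_within)
qed

lemma between_T:
  assumes "a \<in> E" "b \<in> E" "a < x" "x < b"
  shows "(T a < T x \<and> T x < T b) \<or> (T b < T x \<and> T x < T a)"
proof (rule continuous_inj_imp_mono[OF assms(3,4)])
  show "continuous_on {a..b} T" "inj_on T {a..b}"
    using continuous_T Icc_subset_E[OF assms(1,2)] bij
    by (auto intro: continuous_on_subset inj_on_subset simp: bij_betw_def)
qed

text \<open>Were the minimal value 1 taken at an interior point, strict monotonicity on an interval
  around that point would force a value below 1 at one of its ends.\<close>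

lemma T_e0: "T e0 = 1"
proof (rule ccontr)
  assume "T e0 \<noteq> 1"
  then have "S 1 \<noteq> e0" using T_S[of 1] by auto
  then have "e0 < S 1" using S_in_E[of 1] by (auto simp: Ico_def)
  moreover obtain b where "b \<in> E" "S 1 < b" using E_no_max[OF S_in_E[of 1]] by auto
  ultimately show False
    using between_T[OF e0_in_E, of b "S 1"] T_ge_1[of b] T_ge_1[OF e0_in_E] T_S[of 1] by auto
qed

text \<open>A continuous injection is monotone, and a decreasing one is excluded since
  \<open>T\<close> is smallest at \<open>e0\<close>.\<close>

lemma T_less: "x \<in> E \<Longrightarrow> y \<in> E \<Longrightarrow> x < y \<Longrightarrow> T x < T y"
proof (cases "x = e0")
  case True
  assume a: "x \<in> E" "y \<in> E" "x < y"
  then have "T y \<noteq> T e0" using bij True by (metis S_T order_less_irrefl)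
  then show ?thesis using True T_e0 T_ge_1[of y] a by simp
next
  case False
  assume a: "x \<in> E" "y \<in> E" "x < y"
  then have "e0 < x" using False by (auto simp: Ico_def)
  then show ?thesis using between_T[OF e0_in_E a(2) _ a(3)] T_ge_1[of y] T_e0 a by auto
qed

lemma T_le_iff: "x \<in> E \<Longrightarrow> y \<in> E \<Longrightarrow> T x \<le> T y \<longleftrightarrow> x \<le> y"
  using T_less[of x y] T_less[of y x] by (metis linorder_not_le order_le_less)

lemma S_le_iff: "1 \<le> s \<Longrightarrow> x \<in> E \<Longrightarrow> x \<le> S s \<longleftrightarrow> T x \<le> s"
  using T_le_iff[of x "S s"] S_in_E T_S by metis

lemma T_image: "x \<in> E \<Longrightarrow> T ` (E \<inter> {x..}) = {T x..}"
proof safe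
  fix s assume x: "x \<in> E" "T x \<le> s"
  then have "1 \<le> s" using T_ge_1 by force
  then show "s \<in> T ` (E \<inter> {x..})" using x S_le_iff[of s x] T_S[of s] S_in_E[of s]
    by (intro image_eqI[of _ _ "S s"]) auto
qed (auto simp: T_le_iff)

text \<open>This makes derivatives within \<open>E\<close> unique, the one-sided derivative at
  \<open>e0\<close> included.\<close>

lemma at_E_nontrivial: "x \<in> E \<Longrightarrow> at x within E \<noteq> bot"
proof -
  assume x: "x \<in> E"
  obtain b where "b \<in> E" "x < b" using E_no_max[OF x] .
  then have "E \<noteq> {a}" for a using x by auto
  then show ?thesis
    using connected_imp_perfect[of E x] x is_interval_Ico is_interval_connected trivial_limit_within by blast
qed

lemma T_deriv: "x \<in> E \<Longrightarrow> (T has_real_derivative T' x) (at x within E)"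
  and continuous_T': "continuous_on E T'"
proof -
  obtain f' where f': "\<And>x. x \<in> E \<Longrightarrow> (T has_real_derivative f' x) (at x within E)" "continuous_on E f'"
    using diffeo by (auto simp: diffeomorphism_betw_def C1_on_def)
  have eq: "T' x = f' x" if "x \<in> E" for x
    using vector_derivative_within[OF at_E_nontrivial[OF that]] f'(1)[OF that]
    by (simp add: has_real_derivative_iff_has_vector_derivative)
  then show "x \<in> E \<Longrightarrow> (T has_real_derivative T' x) (at x within E)" using f' by simp
  show "continuous_on E T'" using f'(2) eq by (simp cong: continuous_on_cong)
qed

lemma continuous_S: "continuous_on {1..} S"
proof -
  have "\<exists>D. (S has_real_derivative D) (at x within {1..})" if "x \<ge> 1" for x
    using diffeo that by (auto simp: diffeomorphism_betw_def C1_on_def)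
  then show ?thesis
    by (metis DERIV_continuous continuous_on_eq_continuous_within atLeast_iff)
qed

text \<open>Differentiating \<open>S \<circ> T\<close>, the identity on \<open>E\<close>, shows that
  \<open>T' x\<close> is not 0; monotonicity excludes negative values.\<close>

lemma T'_pos:
  assumes x: "x \<in> E"
  shows "0 < T' x"
proof -
  obtain D where "(S has_real_derivative D) (at (T x) within {1..})"
    using diffeo T_ge_1[OF x] by (auto simp: diffeomorphism_betw_def C1_on_def)
  then have "(S has_real_derivative D) (at (T x) within (T ` E))" using bij by (simp add: bij_betw_def)
  from DERIV_image_chain[OF this T_deriv[OF x]]
  have "(S \<circ> T has_real_derivative D * T' x) (at x within E)" .
  then have "((\<lambda>x. x) has_real_derivative D * T' x) (at x within E)"
    by (rule has_field_derivative_transform_within[OF _ zero_less_one x]) (simp add: S_T)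
  moreover have "((\<lambda>x. x) has_real_derivative 1) (at x within E)" by (rule DERIV_ident)
  ultimately have "D * T' x = 1"
    using vector_derivative_unique_within[OF at_E_nontrivial[OF x]]
    unfolding has_real_derivative_iff_has_vector_derivative by blast
  moreover have "0 \<le> T' x"
  proof (rule tendsto_lowerbound)
    show "((\<lambda>y. (T y - T x) / (y - x)) \<longlongrightarrow> T' x) (at x within E)"
      using T_deriv[OF x] by (simp add: has_field_derivative_iff)
    have "0 \<le> (T y - T x) / (y - x)" if "y \<in> E" for y
      using T_le_iff[OF x that] T_le_iff[OF that x] by (cases "x \<le> y") (auto intro: divide_nonneg_nonneg divide_nonpos_nonpos)
    then show "\<forall>\<^sub>F y in at x within E. 0 \<le> (T y - T x) / (y - x)"
      by (auto simp: eventually_at_filter)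
  qed (rule at_E_nontrivial[OF x])
  ultimately show ?thesis by (cases "T' x = 0") auto
qed

text \<open>Every limit at \<open>e1\<close> becomes a limit at infinity in the variable
  \<open>s = T t\<close>.\<close>

lemma filtermap_S: "filtermap S at_top = up_to e1"
proof (rule filter_eqI)
  fix P
  have "(\<exists>N. \<forall>s\<ge>N. P (S s)) \<longleftrightarrow> (\<exists>b\<in>E. \<forall>x\<in>E. b \<le> x \<longrightarrow> P x)" (is "?L \<longleftrightarrow> ?R")
  proof
    assume ?L
    then obtain N where N: "\<And>s. s \<ge> N \<Longrightarrow> P (S s)" by blast
    have "P x" if "x \<in> E" "S (max 1 N) \<le> x" for x
    proof -
      have "max 1 N \<le> T x" using that T_le_iff[of "S (max 1 N)" x] S_in_E[of "max 1 N"] T_S[of "max 1 N"] by simp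
      then show ?thesis using N[of "T x"] S_T[OF that(1)] by simp
    qed
    then show ?R using S_in_E[of "max 1 N"] by auto
  next
    assume ?R
    then obtain b where b: "b \<in> E" "\<And>x. x \<in> E \<Longrightarrow> b \<le> x \<Longrightarrow> P x" by blast
    have "P (S s)" if "s \<ge> T b" for s
    proof -
      have "1 \<le> s" using that T_ge_1[OF b(1)] by simp
      then show ?thesis using b S_in_E S_le_iff that by blast
    qed
    then show ?L by blast
  qed
  then show "eventually P (filtermap S at_top) \<longleftrightarrow> eventually P (up_to e1)"
    by (simp add: eventually_filtermap eventually_at_top_linorder eventually_up_to[OF less])
qed

lemma tendsto_up_to_iff: "(F \<longlongrightarrow> L) (up_to e1) \<longleftrightarrow> ((\<lambda>s. F (S s)) \<longlongrightarrow> L) at_top"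
  unfolding filtermap_S[symmetric] by (simp add: filterlim_filtermap)

text \<open>At \<open>t = S s\<close> the operation \<open>star\<close> becomes multiplication of
  \<open>s\<close> by \<open>T x\<close>, and \<open>e0\<close> is neutral because
  \<open>T e0 = 1\<close>.\<close>

lemma ratio_tendsto_up_to_iff:
  "((\<lambda>t. w (star E T t x) y / w (star E T t e0) z) \<longlongrightarrow> L) (up_to e1) \<longleftrightarrow>
   ((\<lambda>s. w (S (s * T x)) y / w (S s) z) \<longlongrightarrow> L) at_top"
  unfolding tendsto_up_to_iff star_def T_e0
  by (rule tendsto_cong, rule eventually_mono[OF eventually_ge_at_top[of 1]]) (simp add: T_S)

lemma T_RV_iff:
  "w \<in> T_RV e0 e1 T \<beta> h \<longleftrightarrow>
     (\<lambda>(x, y). w x y) \<in> borel_measurable (restrict_space borel (E \<times> UNIV)) \<and>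
     (\<forall>x\<in>E. \<forall>y. 0 \<le> w x y) \<and> (\<forall>x\<in>E. 0 < w x 1) \<and> (\<forall>y. 0 \<le> h y) \<and> h 1 = 1 \<and>
     (\<forall>s\<ge>1. \<forall>y. ((\<lambda>t. w (S (t * s)) y / w (S t) 1) \<longlongrightarrow> s powr \<beta> * h y) at_top)"
proof -
  have "(\<forall>x\<in>E. Q (T x)) \<longleftrightarrow> (\<forall>s\<ge>1. Q s)" for Q :: "real \<Rightarrow> bool"
    using T_ge_1 S_in_E T_S by metis
  from this[of "\<lambda>s. \<forall>y. ((\<lambda>t. w (S (t * s)) y / w (S t) 1) \<longlongrightarrow> s powr \<beta> * h y) at_top"]
  show ?thesis unfolding T_RV_def ratio_tendsto_up_to_iff by simp
qed

text \<open>Density of the image under \<open>T\<close> of the measure on \<open>[e0, e1)\<close> with density \<open>g\<close>.\<close>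

definition pull :: "(real \<Rightarrow> real) \<Rightarrow> real \<Rightarrow> real" where
  "pull g s = (if 1 \<le> s then g (S s) / T' (S s) else 0)"

lemma pull_borel:
  assumes [measurable]: "g \<in> borel_measurable borel"
  shows "pull g \<in> borel_measurable borel"
proof -
  \<comment> \<open>\<open>S\<close> and \<open>T'\<close> are continuous on \<open>{1..}\<close>
    and on \<open>E\<close>; the constants \<open>e0\<close> and 1 extend them to measurable
    functions on the whole line.\<close>
  have [measurable]: "(\<lambda>s. if s \<in> {1..} then S s else e0) \<in> borel_measurable borel"
    using borel_measurable_continuous_on_restrict[OF continuous_S]
    by (subst (asm) measurable_restrict_space_iff[where c = e0]) auto
  have [measurable]: "(\<lambda>x. if x \<in> E then T' x else 1) \<in> borel_measurable borel"
    using borel_measurable_continuous_on_restrict[OF continuous_T']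
    by (subst (asm) measurable_restrict_space_iff[where c = 1]) auto
  have "(\<lambda>s. if s \<in> {1..} then g (if s \<in> {1..} then S s else e0) /
      (\<lambda>x. if x \<in> E then T' x else 1) (if s \<in> {1..} then S s else e0) else 0) \<in> borel_measurable borel"
    by measurable
  also have "(\<lambda>s. if s \<in> {1..} then g (if s \<in> {1..} then S s else e0) /
      (\<lambda>x. if x \<in> E then T' x else 1) (if s \<in> {1..} then S s else e0) else 0) = pull g"
    by (auto simp: pull_def fun_eq_iff S_in_E)
  finally show ?thesis .
qed

text \<open>The substitution \<open>s = T z\<close> maps \<open>E \<inter> {x..}\<close> onto
  \<open>{T x..}\<close>, and the Jacobian \<open>T'\<close> cancels the denominator in
  \<open>pull g\<close>. As \<open>g\<close> vanishes off \<open>E\<close>, its integral over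
  \<open>E \<inter> {x..}\<close> is the whole tail.\<close>

lemma
  assumes g: "integrable lborel g" and zero: "\<And>x. x \<notin> E \<Longrightarrow> g x = 0"
  shows integrable_pull: "integrable lborel (pull g)"
    and tail_pull: "\<And>x. x \<in> E \<Longrightarrow> tail (pull g) (T x) = tail g x"
proof -
  have gm[measurable]: "g \<in> borel_measurable borel" using g by auto
  have cov: "set_integrable lebesgue {T x..} (pull g)" "integral {T x..} (pull g) = tail g x" if x: "x \<in> E" for x
  proof -
    let ?X = "E \<inter> {x..}"
    have eq: "\<bar>T' z\<bar> * pull g (T z) = g z" if "z \<in> ?X" for z
      using that T'_pos[of z] T_ge_1[of z] by (simp add: pull_def S_T)
    have X: "?X \<in> sets borel" by measurable
    have int: "set_integrable lborel ?X g" by (rule set_integrable_of_integrable[OF g X])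
    \<comment> \<open>The change of variables is carried out for Lebesgue measure; Borel
      measurability of \<open>pull g\<close> later leads back to \<open>lborel\<close>.\<close>
    then have "set_integrable lebesgue ?X g"
      unfolding set_integrable_def by (subst integrable_completion) auto
    then have "(\<lambda>z. \<bar>T' z\<bar> * pull g (T z)) absolutely_integrable_on ?X"
      by (rule set_integrable_cong[THEN iffD1, rotated -1]) (auto simp: eq)
    moreover have "integral ?X (\<lambda>z. \<bar>T' z\<bar> * pull g (T z)) = integral ?X g"
      by (rule integral_cong) (rule eq)
    moreover have "integral ?X g = (LBINT z:?X. g z)"
      using set_borel_integral_eq_integral(2)[OF int] by simp
    moreover have "\<dots> = tail g x"
      unfolding tail_def set_lebesgue_integral_def using zero
      by (intro Bochner_Integration.integral_cong) (auto simp: indicator_def)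
    ultimately have "pull g absolutely_integrable_on (T ` ?X) \<and> integral (T ` ?X) (pull g) = tail g x"
      using has_absolute_integral_change_of_variables_1'[of ?X T T' "pull g" "tail g x"] T_deriv X bij
      by (fastforce simp: bij_betw_def intro: inj_on_subset has_field_derivative_subset)
    then show "set_integrable lebesgue {T x..} (pull g)" "integral {T x..} (pull g) = tail g x"
      by (simp_all add: T_image[OF x])
  qed
  \<comment> \<open>The case \<open>x = e0\<close> covers \<open>{1..}\<close>, outside which
    \<open>pull g\<close> is 0.\<close>
  have "(\<lambda>s. indicator {1..} s *\<^sub>R pull g s) = pull g" by (auto simp: pull_def indicator_def)
  then show int: "integrable lborel (pull g)"
    using cov(1)[OF e0_in_E] integrable_completion[of "pull g" lborel] pull_borel[OF gm]
    by (simp add: set_integrable_def T_e0)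
  show "tail (pull g) (T x) = tail g x" if "x \<in> E" for x
    unfolding tail_def[of "pull g"] cov(2)[OF that, symmetric]
    by (rule set_borel_integral_eq_integral(2)) (auto intro: set_integrable_of_integrable int)
qed

end

section \<open>The density u and its tail integral U\<close>

locale decay_density = decay +
  fixes \<alpha> :: real and u :: "real \<Rightarrow> real ^ 'n \<Rightarrow> real" and h :: "real ^ 'n \<Rightarrow> real"
  assumes \<alpha>: "0 < \<alpha>"
    and u_measurable: "(\<lambda>(x, y). u x y) \<in> borel_measurable (restrict_space borel (E \<times> UNIV))"
    and u_nonneg: "\<And>x y. x \<in> E \<Longrightarrow> 0 \<le> u x y"
    and u_pos: "\<And>x. x \<in> E \<Longrightarrow> 0 < u x 1"
    and h_nonneg: "\<And>y. 0 \<le> h y"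
    and h_pivot: "h 1 = 1"
    and u_integrable: "\<And>x y. x \<in> E \<Longrightarrow> interval_lebesgue_integrable lborel (ereal x) e1 (\<lambda>z. u z y)"
begin

abbreviation U :: "real \<Rightarrow> real ^ 'n \<Rightarrow> real" where "U \<equiv> tail_integral e1 u"

definition ext :: "real ^ 'n \<Rightarrow> real \<Rightarrow> real" where
  "ext y z = (if z \<in> E then u z y else 0)"

abbreviation v :: "real \<Rightarrow> real ^ 'n \<Rightarrow> real" where "v s y \<equiv> pull (ext y) s"

lemma borel_E_UNIV: "E \<times> (UNIV :: (real ^ 'n) set) \<in> sets borel"
  by (subst borel_prod[symmetric]) auto

lemma ext_measurable: "(\<lambda>p. ext (snd p) (fst p)) \<in> borel_measurable (borel \<Otimes>\<^sub>M borel)"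
proof -
  have "(\<lambda>p. if p \<in> E \<times> UNIV then (\<lambda>(x, y). u x y) p else 0) \<in> borel_measurable borel"
    using u_measurable borel_E_UNIV by (subst (asm) measurable_restrict_space_iff[where c = 0]) auto
  also have "(\<lambda>p. if p \<in> E \<times> UNIV then (\<lambda>(x, y). u x y) p else 0) = (\<lambda>p. ext (snd p) (fst p))"
    by (auto simp: ext_def fun_eq_iff)
  finally show ?thesis by (simp only: borel_prod)
qed

lemma ext_borel[measurable]: "ext y \<in> borel_measurable borel"
proof -
  have "(\<lambda>z. (z, y)) \<in> borel \<rightarrow>\<^sub>M borel \<Otimes>\<^sub>M borel" by measurable
  from measurable_compose[OF this ext_measurable] show ?thesis by simp
qed

lemma ext_nonneg: "0 \<le> ext y z"
  by (simp add: ext_def u_nonneg)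

lemma einterval_E: "x \<in> E \<Longrightarrow> einterval (ereal x) e1 = E \<inter> {x<..}"
  by (auto simp: einterval_iff Ico_def)

lemma integrable_ext: "integrable lborel (ext y)"
proof -
  have "set_integrable lborel (einterval (ereal e0) e1) (\<lambda>z. u z y)"
    using u_integrable[OF e0_in_E] less by (simp add: interval_lebesgue_integrable_def)
  \<comment> \<open>The interval integral uses the open interval; the added end point
    \<open>e0\<close> is a null set.\<close>
  then have "set_integrable lborel E (\<lambda>z. u z y)"
    by (rule set_integrable_discrete_difference[where X = "{e0}", THEN iffD1, rotated -1])
      (auto simp: einterval_E[OF e0_in_E] Ico_def)
  moreover have "(\<lambda>z. indicator E z *\<^sub>R u z y) = ext y" by (auto simp: ext_def indicator_def)
  ultimately show ?thesis by (simp add: set_integrable_def)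
qed

lemma U_eq_tail: "x \<in> E \<Longrightarrow> U x y = tail (ext y) x"
proof -
  assume x: "x \<in> E"
  then have "ereal x \<le> e1" by (simp add: Ico_def less_imp_le)
  then have "U x y = (LBINT z:E \<inter> {x<..}. u z y)"
    by (simp add: tail_integral_def interval_lebesgue_integral_def einterval_E[OF x])
  also have "\<dots> = (LBINT z:{x<..}. ext y z)"
    unfolding set_lebesgue_integral_def
    by (intro Bochner_Integration.integral_cong) (auto simp: ext_def indicator_def)
  also have "\<dots> = (LBINT z:{x..}. ext y z)"
    by (rule set_integral_discrete_difference[where X = "{x}"]) auto
  finally show ?thesis by (simp add: tail_def)
qed

text \<open>The integrand, with its range of integration written as an indicator, is jointly
  measurable in the point, the parameter and the integration variable; integrating out the last one
  preserves measurability.\<close>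

lemma U_measurable: "(\<lambda>(x, y). U x y) \<in> borel_measurable (restrict_space borel (E \<times> UNIV))"
proof -
  have "(\<lambda>(p, z). indicator {fst p..} z *\<^sub>R ext (snd p) z)
      \<in> borel_measurable ((borel \<Otimes>\<^sub>M borel) \<Otimes>\<^sub>M (lborel :: real measure))"
  proof -
    have 1: "(\<lambda>q. (snd q, snd (fst q))) \<in> ((borel \<Otimes>\<^sub>M borel) \<Otimes>\<^sub>M (lborel :: real measure)) \<rightarrow>\<^sub>M borel \<Otimes>\<^sub>M borel"
      by measurable
    have [measurable]: "(\<lambda>q. ext (snd (fst q)) (snd q)) \<in> borel_measurable ((borel \<Otimes>\<^sub>M borel) \<Otimes>\<^sub>M (lborel :: real measure))"
      using measurable_compose[OF 1 ext_measurable] by simp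
    have "(\<lambda>q. if fst (fst q) \<le> snd q then ext (snd (fst q)) (snd q) else 0)
        \<in> borel_measurable ((borel \<Otimes>\<^sub>M borel) \<Otimes>\<^sub>M (lborel :: real measure))"
      by measurable
    also have "(\<lambda>q. if fst (fst q) \<le> snd q then ext (snd (fst q)) (snd q) else 0) =
        (\<lambda>(p, z). indicator {fst p..} z *\<^sub>R ext (snd p) z)"
      by (auto simp: fun_eq_iff indicator_def)
    finally show ?thesis .
  qed
  from lborel.borel_measurable_lebesgue_integral[OF this]
  have "(\<lambda>p. tail (ext (snd p)) (fst p)) \<in> borel_measurable borel"
    by (simp add: tail_def set_lebesgue_integral_def borel_prod)
  from measurable_restrict_space1[OF this]
  have "(\<lambda>p. tail (ext (snd p)) (fst p)) \<in> borel_measurable (restrict_space borel (E \<times> UNIV))" .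
  then show ?thesis
    by (rule measurable_cong[THEN iffD1, rotated]) (auto simp: space_restrict_space U_eq_tail)
qed

lemma first_measurable:
  assumes "f \<in> borel_measurable (restrict_space borel E)"
  shows "(\<lambda>(x, y :: real ^ 'n). f x) \<in> borel_measurable (restrict_space borel (E \<times> UNIV))"
proof -
  have "(fst :: real \<times> (real ^ 'n) \<Rightarrow> real) \<in> borel_measurable borel"
    by (subst borel_prod[symmetric]) measurable
  then have "fst \<in> restrict_space borel (E \<times> (UNIV :: (real ^ 'n) set)) \<rightarrow>\<^sub>M restrict_space borel E"
    by (intro measurable_restrict_space3) auto
  from measurable_compose[OF this assms] show ?thesis by (simp add: case_prod_unfold)
qed

lemma section_measurable:
  assumes "(\<lambda>(x, y). f x y) \<in> borel_measurable (restrict_space borel (E \<times> UNIV))"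
  shows "(\<lambda>x. f x (y :: real ^ 'n)) \<in> borel_measurable (restrict_space borel E)"
proof -
  have "(\<lambda>x::real. (x, y)) \<in> borel_measurable borel"
    by (subst borel_prod[symmetric]) measurable
  then have "(\<lambda>x. (x, y)) \<in> restrict_space borel E \<rightarrow>\<^sub>M restrict_space borel (E \<times> UNIV)"
    by (intro measurable_restrict_space3) auto
  from measurable_compose[OF this assms] show ?thesis by simp
qed

lemma v_eq: "1 \<le> s \<Longrightarrow> v s y = u (S s) y / T' (S s)"
  by (simp add: pull_def ext_def S_in_E)

lemma integrable_v: "integrable lborel (\<lambda>s. v s y)"
  using integrable_pull[OF integrable_ext[of y]] by (simp add: ext_def)

lemma v_nonneg: "0 \<le> v s y"
  using T'_pos[OF S_in_E, of s] by (simp add: pull_def ext_nonneg less_imp_le)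

lemma v_pos: "1 \<le> s \<Longrightarrow> 0 < v s 1"
  using T'_pos[OF S_in_E, of s] u_pos[OF S_in_E, of s] by (simp add: v_eq)

lemma tail_v: "1 \<le> s \<Longrightarrow> tail (\<lambda>r. v r y) s = U (S s) y"
  using tail_pull[OF integrable_ext[of y], of "S s"]
  by (simp add: ext_def S_in_E T_S U_eq_tail[OF S_in_E])

lemma U_pos: "x \<in> E \<Longrightarrow> 0 < U x 1"
proof -
  assume x: "x \<in> E"
  have "0 < tail (\<lambda>r. v r 1) (T x)"
    by (rule tail_v_pos[OF integrable_v v_nonneg v_pos \<alpha> T_ge_1[OF x]])
  then show ?thesis using tail_v[OF T_ge_1[OF x], of 1] S_T[OF x] by simp
qed

lemma U_nonneg: "x \<in> E \<Longrightarrow> 0 \<le> U x y"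
  by (simp add: U_eq_tail tail_nonneg ext_nonneg)

section \<open>Karamata's theorem translated back to u and U\<close>

lemmas density_Karamata = Karamata_family[where v = v and p = 1 and h = h, OF integrable_v v_nonneg v_pos \<alpha> h_pivot]

lemma density_RV_iff:
  "(\<lambda>x y. u x y / T' x) \<in> T_RV e0 e1 T (- \<alpha> - 1) h \<longleftrightarrow>
    (\<forall>s\<ge>1. \<forall>y. ((\<lambda>t. v (t * s) y / v t 1) \<longlongrightarrow> s powr (- \<alpha> - 1) * h y) at_top)"
proof -
  have "(\<lambda>(x, y). u x y / T' x) = (\<lambda>p. (\<lambda>(x, y). u x y) p / (\<lambda>(x, y :: real ^ 'n). T' x) p)"
    by auto
  moreover have "\<dots> \<in> borel_measurable (restrict_space borel (E \<times> UNIV))"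
    by (intro borel_measurable_divide u_measurable first_measurable
        borel_measurable_continuous_on_restrict continuous_T')
  ultimately have "(\<lambda>(x, y). u x y / T' x) \<in> borel_measurable (restrict_space borel (E \<times> UNIV))"
    by simp
  moreover have "((\<lambda>t. u (S (t * s)) y / T' (S (t * s)) / (u (S t) 1 / T' (S t))) \<longlongrightarrow> L) at_top \<longleftrightarrow>
      ((\<lambda>t. v (t * s) y / v t 1) \<longlongrightarrow> L) at_top" if "1 \<le> s" for s y L
  proof (rule tendsto_cong, rule eventually_mono[OF eventually_ge_at_top[of 1]])
    fix t :: real assume "1 \<le> t"
    then show "u (S (t * s)) y / T' (S (t * s)) / (u (S t) 1 / T' (S t)) = v (t * s) y / v t 1"
      using that mult_mono[of 1 t 1 s] by (simp only: v_eq mult_1_left zero_le_one)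
  qed
  ultimately show ?thesis
    unfolding T_RV_iff using u_nonneg u_pos T'_pos h_nonneg h_pivot by (simp add: less_imp_le)
qed

text \<open>At \<open>t = S s\<close> the factor \<open>T t\<close> is \<open>s\<close>, division by
  \<open>T' t\<close> turns \<open>u\<close> into \<open>v\<close>, and \<open>U\<close> becomes the
  tail of \<open>v\<close>.\<close>

lemma Karamata_limit_iff:
  "((\<lambda>t. T t / T' t * (u t y / U t 1)) \<longlongrightarrow> L) (up_to e1) \<longleftrightarrow>
    ((\<lambda>t. t * v t y / tail (\<lambda>r. v r 1) t) \<longlongrightarrow> L) at_top"
  unfolding tendsto_up_to_iff
  by (rule tendsto_cong, rule eventually_mono[OF eventually_ge_at_top[of 1]])
    (simp add: v_eq tail_v T_S)

lemma density_RV_iff_limit: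
  "(\<lambda>x y. u x y / T' x) \<in> T_RV e0 e1 T (- \<alpha> - 1) h \<longleftrightarrow>
    (\<forall>y. ((\<lambda>t. T t / T' t * (u t y / U t 1)) \<longlongrightarrow> \<alpha> * h y) (up_to e1))"
  unfolding density_RV_iff Karamata_limit_iff by (rule density_Karamata(1))

lemma U_ratio_tendsto:
  assumes "(\<lambda>x y. u x y / T' x) \<in> T_RV e0 e1 T (- \<alpha> - 1) h" "1 \<le> s"
  shows "((\<lambda>t. U (S (t * s)) y / U (S t) 1) \<longlongrightarrow> s powr (-\<alpha>) * h y) at_top"
proof (rule Lim_transform_eventually)
  show "((\<lambda>t. tail (\<lambda>r. v r y) (t * s) / tail (\<lambda>r. v r 1) t) \<longlongrightarrow> s powr (-\<alpha>) * h y) at_top"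
    by (intro density_Karamata(2) assms(1)[unfolded density_RV_iff] assms(2))
  show "\<forall>\<^sub>F t in at_top. tail (\<lambda>r. v r y) (t * s) / tail (\<lambda>r. v r 1) t = U (S (t * s)) y / U (S t) 1"
    using eventually_ge_at_top[of 1]
  proof eventually_elim
    case (elim t)
    then have "1 \<le> t * s" using assms(2) mult_mono[of 1 t 1 s] by simp
    then show ?case using elim by (simp only: tail_v)
  qed
qed

lemma U_RV:
  assumes "(\<lambda>x y. u x y / T' x) \<in> T_RV e0 e1 T (- \<alpha> - 1) h"
  shows "U \<in> T_RV e0 e1 T (- \<alpha>) h"
  unfolding T_RV_iff
  using U_measurable U_nonneg U_pos h_nonneg h_pivot U_ratio_tendsto[OF assms] by simp

lemma U_quotient_tendsto:
  assumes "(\<lambda>x y. u x y / T' x) \<in> T_RV e0 e1 T (- \<alpha> - 1) h"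
  shows "((\<lambda>t. U t y / U t 1) \<longlongrightarrow> h y) (up_to e1)"
  using U_ratio_tendsto[OF assms, of 1 y] by (simp add: tendsto_up_to_iff)

section \<open>The representation of U\<close>

lemma U_quotient_measurable:
  "(\<lambda>(x, y). U x y / U x 1) \<in> borel_measurable (restrict_space borel (E \<times> UNIV))"
proof -
  have "(\<lambda>p. (\<lambda>(x, y). U x y) p / (\<lambda>(x, y :: real ^ 'n). U x 1) p) \<in> borel_measurable (restrict_space borel (E \<times> UNIV))"
    by (intro borel_measurable_divide U_measurable first_measurable section_measurable)
  then show ?thesis by (simp add: case_prod_unfold)
qed

text \<open>The exponent \<open>a\<close> is chosen so that
  \<open>a z * (T' z / T z) = - u z 1 / U z 1\<close>, formally the logarithmic derivative of
  \<open>U\<close> at the pivot; \<open>log_tail_diff\<close> integrates it.\<close>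

lemma
  defines "a \<equiv> \<lambda>z. - (T z / T' z * (u z 1 / U z 1))"
  shows exponent_measurable: "a \<in> borel_measurable (restrict_space borel E)"
    and exponent_integrable:
      "\<And>x. x \<in> E \<Longrightarrow> interval_lebesgue_integrable lborel (ereal e0) (ereal x) (\<lambda>z. a z * (T' z / T z))"
    and exponent_integral:
      "\<And>x. x \<in> E \<Longrightarrow> U e0 1 * exp (LBINT z=ereal e0..ereal x. a z * (T' z / T z)) = U x 1"
proof -
  show "a \<in> borel_measurable (restrict_space borel E)" unfolding a_def
    by (intro borel_measurable_uminus borel_measurable_times borel_measurable_divide section_measurable
        u_measurable U_measurable borel_measurable_continuous_on_restrict continuous_T continuous_T')
  fix x assume x: "x \<in> E"
  have le: "e0 \<le> x" using x by (simp add: Ico_def)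
  have eq: "- (ext 1 z / tail (ext 1) z) = a z * (T' z / T z)" if "z \<in> {e0..x}" for z
  proof -
    have z: "z \<in> E" using Icc_subset_E[OF e0_in_E x] that by blast
    show ?thesis using T'_pos[OF z] T_ge_1[OF z] by (simp add: a_def ext_def z U_eq_tail[OF z])
  qed
  have pos: "0 < tail (ext 1) x" using U_pos[OF x] U_eq_tail[OF x] by simp
  note L = log_tail_diff[OF integrable_ext[of 1] ext_nonneg le pos]
  have int: "set_integrable lborel {e0..x} (\<lambda>z. - (ext 1 z / tail (ext 1) z))"
    using L(1) by (simp add: set_integrable_def)
  then have int': "set_integrable lborel {e0..x} (\<lambda>z. a z * (T' z / T z))"
    by (rule set_integrable_cong[THEN iffD1, rotated -1]) (auto simp: eq)
  then show "interval_lebesgue_integrable lborel (ereal e0) (ereal x) (\<lambda>z. a z * (T' z / T z))"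
    using le by (auto simp: interval_lebesgue_integrable_def intro: set_integrable_subset)
  have "(LBINT z=ereal e0..ereal x. a z * (T' z / T z)) = (LBINT z:{e0..x}. a z * (T' z / T z))"
    by (rule interval_integral_Icc[OF le])
  also have "\<dots> = (LBINT z:{e0..x}. - (ext 1 z / tail (ext 1) z))"
    by (rule set_lebesgue_integral_cong) (auto simp: eq)
  also have "\<dots> = ln (U x 1) - ln (U e0 1)"
    using L(2) by (simp add: set_lebesgue_integral_def U_eq_tail x e0_in_E)
  finally show "U e0 1 * exp (LBINT z=ereal e0..ereal x. a z * (T' z / T z)) = U x 1"
    using U_pos[OF x] U_pos[OF e0_in_E] by (simp add: exp_diff)
qed

lemma U_representation:
  assumes RV: "(\<lambda>x y. u x y / T' x) \<in> T_RV e0 e1 T (- \<alpha> - 1) h"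
  shows "\<exists>a q.
    a \<in> borel_measurable (restrict_space borel E) \<and>
    (\<lambda>(x, y). q x y) \<in> borel_measurable (restrict_space borel (E \<times> (UNIV :: (real ^ 'n) set))) \<and>
    (a \<longlongrightarrow> - \<alpha>) (up_to e1) \<and>
    (\<forall>y. ((\<lambda>t. q t y) \<longlongrightarrow> h y) (up_to e1)) \<and>
    (\<forall>x\<in>E. interval_lebesgue_integrable lborel (ereal e0) (ereal x) (\<lambda>z. a z * (T' z / T z))) \<and>
    (\<forall>x\<in>E. \<forall>y. U x y = U e0 1 * exp (LBINT z=ereal e0..ereal x. a z * (T' z / T z)) * q x y)"
proof (intro exI conjI)
  \<comment> \<open>The limit of the exponent is the criterion at the pivot, where \<open>h\<close>
    equals 1.\<close>
  have "((\<lambda>t. T t / T' t * (u t 1 / U t 1)) \<longlongrightarrow> \<alpha>) (up_to e1)"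
    using RV[unfolded density_RV_iff_limit, rule_format, of 1] h_pivot by simp
  then show "((\<lambda>z. - (T z / T' z * (u z 1 / U z 1))) \<longlongrightarrow> - \<alpha>) (up_to e1)"
    by (rule tendsto_minus)
  show "\<forall>y. ((\<lambda>t. U t y / U t 1) \<longlongrightarrow> h y) (up_to e1)"
    using U_quotient_tendsto[OF RV] by blast
  show "\<forall>x\<in>E. \<forall>y. U x y = U e0 1 *
      exp (LBINT z=ereal e0..ereal x. - (T z / T' z * (u z 1 / U z 1)) * (T' z / T z)) * (U x y / U x 1)"
  proof (intro ballI allI)
    fix x y assume x: "x \<in> E"
    show "U x y = U e0 1 *
      exp (LBINT z=ereal e0..ereal x. - (T z / T' z * (u z 1 / U z 1)) * (T' z / T z)) * (U x y / U x 1)"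
      unfolding exponent_integral[OF x] using U_pos[OF x] by simp
  qed
qed (use exponent_measurable exponent_integrable U_quotient_measurable in auto)

end

theorem theorem0p3:
  fixes e0 :: real and e1 :: ereal and T :: "real \<Rightarrow> real" and \<alpha> :: real
    and u :: "real \<Rightarrow> real ^ 'n \<Rightarrow> real" and h :: "real ^ 'n \<Rightarrow> real"
    and E :: "real set" and T' :: "real \<Rightarrow> real" and U :: "real \<Rightarrow> real ^ 'n \<Rightarrow> real"
  defines "E \<equiv> Ico e0 e1"
    and "T' \<equiv> deriv_within T E"
    and "U \<equiv> tail_integral e1 u"
  assumes "ereal e0 < e1"
    and "diffeomorphism_betw T E {1..}"
    and "\<alpha> > 0"
    and "(\<lambda>(x, y). u x y) \<in> borel_measurable (restrict_space borel (E \<times> UNIV))"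
    and "\<And>x y. x \<in> E \<Longrightarrow> 0 \<le> u x y"
    and "\<And>x. x \<in> E \<Longrightarrow> 0 < u x 1"
    and "\<And>y. 0 \<le> h y"
    and "h 1 = 1"
    and "\<And>x y. x \<in> E \<Longrightarrow> interval_lebesgue_integrable lborel (ereal x) e1 (\<lambda>z. u z y)"
  shows
    "((\<lambda>x y. u x y / T' x) \<in> T_RV e0 e1 T (- \<alpha> - 1) h \<longleftrightarrow>
       (\<forall>y. ((\<lambda>t. T t / T' t * (u t y / U t 1)) \<longlongrightarrow> \<alpha> * h y) (up_to e1)))
     \<and>
     ((\<lambda>x y. u x y / T' x) \<in> T_RV e0 e1 T (- \<alpha> - 1) h \<longrightarrow>
       U \<in> T_RV e0 e1 T (- \<alpha>) h \<and>
       (\<exists>a q.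
          a \<in> borel_measurable (restrict_space borel E) \<and>
          (\<lambda>(x, y). q x y) \<in> borel_measurable (restrict_space borel (E \<times> (UNIV :: (real ^ 'n) set))) \<and>
          (a \<longlongrightarrow> - \<alpha>) (up_to e1) \<and>
          (\<forall>y. ((\<lambda>t. q t y) \<longlongrightarrow> h y) (up_to e1)) \<and>
          (\<forall>x\<in>E. interval_lebesgue_integrable lborel (ereal e0) (ereal x) (\<lambda>z. a z * (T' z / T z))) \<and>
          (\<forall>x\<in>E. \<forall>y. U x y =
             U e0 1 * exp (LBINT z=ereal e0..ereal x. a z * (T' z / T z)) * q x y)))"
proof -
  interpret decay_density e0 e1 T \<alpha> u h
    using assms(4-) unfolding E_def by unfold_locales
  show ?thesis
    unfolding E_def T'_def U_def using density_RV_iff_limit U_RV U_representation by blast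
qed

end
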